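(* Let $L_d$ be the language defined in the context. The number of random bits used by any probabilistic (bounded-error, polynomial-time) algorithm $A$ which accepts $L_d$ cannot be reduced to $O(\log n)$; that is, there is no probabilistic polynomial-time algorithm accepting $L_d$ (with acceptance probability $\ge\frac23$ on members and $\le\frac13$ on non-members) that uses only $O(\log n)$ random bits on inputs of length $n$.
   Context: Single-tape deterministic Turing machines with input alphabet $\{0,1\}$, states $q_1,\dots,q_s$ ($q_1$ initial, $q_s$ accepting), tape alphabet $X_1,\dots,X_t$ ($X_1$ blank, $X_2=0$, $X_3=1$) are encoded by concatenating, in any order, the strings $10^i10^j10^k10^l10^m1$ for each transition $\delta(q_i,X_j)=(q_k,X_l,D_m)$ ($D_1,D_2,D_3=L,R,S$), optionally prefixed by extra $1$'s. A pair $(M,k)$, where $M$ halts within $n^k+k$ steps on every input of length $n$ and $k$ is minimal with this property, is encoded by appending $10^k1$ to an encoding of $M$. The probabilistic machine $M_0$, on input $x$ of length $n$: if $x$ does not encode such a pair, it rejects; otherwise it decodes $(M,k)$ and simulates $M$ on input $x$ with a universal simulator, counting simulation steps up to $n^{k+1}-2$; if $M$ accepts or the counter overflows it enters a state $q_{pa}$, and if $M$ halts without accepting it enters a state $q_{pr}$. From $q_{pr}$ it accepts with probability $\frac23+\epsilon$ and rejects with probability $\frac13-\epsilon$; from $q_{pa}$ it rejects with probability $\frac23+\epsilon$ and accepts with probability $\frac13-\epsilon$ (here $\epsilon>0$ is a small rational). $L_d$ is the language accepted by $M_0$ with probability $\ge\frac23$, i.e. the set of $x$ for which $M_0$ reaches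 $q_{pr}$. *)

theory Defs
  imports Complex_Main
begin

datatype dir = Lt | Rt | St

definition move :: "dir \<Rightarrow> int \<Rightarrow> int" where
  "move d h = (case d of Lt \<Rightarrow> h - 1 | Rt \<Rightarrow> h + 1 | St \<Rightarrow> h)"

text \<open>A transition (i,j,k,l,m) means delta(q_i, X_j) = (q_k, X_l, D_m).\<close>
type_synonym trans = "nat \<times> nat \<times> nat \<times> nat \<times> nat"

definition dir_of :: "nat \<Rightarrow> dir" where
  "dir_of m = (if m = 1 then Lt else if m = 2 then Rt else St)"

definition valid_tm :: "trans list \<Rightarrow> bool" where
  "valid_tm ts \<longleftrightarrow>
     (\<forall>(i,j,k,l,m)\<in>set ts. i \<ge> 1 \<and> j \<ge> 1 \<and> k \<ge> 1 \<and> l \<ge> 1 \<and> m \<in> {1,2,3}) \<and>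
     distinct (map (\<lambda>(i,j,k,l,m). (i,j)) ts)"

definition tm_delta :: "trans list \<Rightarrow> nat \<Rightarrow> nat \<Rightarrow> (nat \<times> nat \<times> dir) option" where
  "tm_delta ts q a =
     map_option (\<lambda>(k,l,m). (k, l, dir_of m)) (map_of (map (\<lambda>(i,j,k,l,m). ((i,j),(k,l,m))) ts) (q,a))"

definition tm_acc :: "trans list \<Rightarrow> nat" where
  "tm_acc ts = Max (insert 1 ((\<lambda>(i,j,k,l,m). i) ` set ts \<union> (\<lambda>(i,j,k,l,m). k) ` set ts))"

text \<open>Configurations: (state, tape, head position). Tape symbols: 1 = blank, 2 = 0, 3 = 1.\<close>
type_synonym dconf = "nat \<times> (int \<Rightarrow> nat) \<times> int"

definition sym_of :: "bool \<Rightarrow> nat" where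
  "sym_of b = (if b then 3 else 2)"

definition init_tape :: "bool list \<Rightarrow> int \<Rightarrow> nat" where
  "init_tape x i = (if 0 \<le> i \<and> i < int (length x) then sym_of (x ! nat i) else 1)"

definition dstep :: "trans list \<Rightarrow> dconf \<Rightarrow> dconf option" where
  "dstep ts c = (case c of (q, tp, h) \<Rightarrow>
     if q = tm_acc ts then None else
     (case tm_delta ts q (tp h) of None \<Rightarrow> None
      | Some (q', a, d) \<Rightarrow> Some (q', tp(h := a), move d h)))"

definition dhalted :: "trans list \<Rightarrow> dconf \<Rightarrow> bool" where
  "dhalted ts c \<longleftrightarrow> dstep ts c = None"

fun dconf_at :: "trans list \<Rightarrow> bool list \<Rightarrow> nat \<Rightarrow> dconf" where
  "dconf_at ts x 0 = (1, init_tape x, 0)"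
| "dconf_at ts x (Suc t) = (case dstep ts (dconf_at ts x t) of None \<Rightarrow> dconf_at ts x t | Some c \<Rightarrow> c)"

definition time_ok :: "trans list \<Rightarrow> nat \<Rightarrow> bool" where
  "time_ok ts k \<longleftrightarrow> (\<forall>x. dhalted ts (dconf_at ts x (length x ^ k + k)))"

definition time_exact :: "trans list \<Rightarrow> nat \<Rightarrow> bool" where
  "time_exact ts k \<longleftrightarrow> time_ok ts k \<and> (\<forall>k' < k. \<not> time_ok ts k')"

definition code_trans :: "trans \<Rightarrow> bool list" where
  "code_trans tr = (case tr of (i,j,k,l,m) \<Rightarrow>
     [True] @ replicate i False @ [True] @ replicate j False @ [True] @ replicate k False @
     [True] @ replicate l False @ [True] @ replicate m False @ [True])"

definition encodes_pair :: "bool list \<Rightarrow> trans list \<Rightarrow> nat \<Rightarrow> bool" where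
  "encodes_pair x ts k \<longleftrightarrow> valid_tm ts \<and> distinct ts \<and> time_exact ts k \<and>
     (\<exists>p. x = replicate p True @ concat (map code_trans ts) @ [True] @ replicate k False @ [True])"

definition Ld :: "bool list set" where
  "Ld = {x. \<exists>ts k. encodes_pair x ts k \<and>
          (let c = dconf_at ts x (length x ^ (k + 1) - 2)
           in dhalted ts c \<and> fst c \<noteq> tm_acc ts)}"

text \<open>In a coin state q the transition is chosen by the next random bit b;
  in other states the bit argument is False. Initial state 1, accepting state pacc.\<close>
datatype ptm = PTM (pdelta: "nat \<Rightarrow> nat \<Rightarrow> bool \<Rightarrow> (nat \<times> nat \<times> dir) option")
                   (pcoin: "nat \<Rightarrow> bool") (pacc: nat)

definition finite_ptm :: "ptm \<Rightarrow> bool" where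
  "finite_ptm A \<longleftrightarrow> finite {(q,a,b). pdelta A q a b \<noteq> None}"

text \<open>Configurations: (state, tape, head, number of random bits used so far).\<close>
type_synonym pconf = "nat \<times> (int \<Rightarrow> nat) \<times> int \<times> nat"

definition pstep :: "ptm \<Rightarrow> (nat \<Rightarrow> bool) \<Rightarrow> pconf \<Rightarrow> pconf option" where
  "pstep A cs c = (case c of (q, tp, h, u) \<Rightarrow>
     if q = pacc A then None else
     (let b = (if pcoin A q then cs u else False);
          u' = (if pcoin A q then Suc u else u)
      in case pdelta A q (tp h) b of None \<Rightarrow> None
         | Some (q', a, d) \<Rightarrow> Some (q', tp(h := a), move d h, u')))"

definition phalted :: "ptm \<Rightarrow> (nat \<Rightarrow> bool) \<Rightarrow> pconf \<Rightarrow> bool" where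
  "phalted A cs c \<longleftrightarrow> pstep A cs c = None"

fun pconf_at :: "ptm \<Rightarrow> bool list \<Rightarrow> (nat \<Rightarrow> bool) \<Rightarrow> nat \<Rightarrow> pconf" where
  "pconf_at A x cs 0 = (1, init_tape x, 0, 0)"
| "pconf_at A x cs (Suc t) =
     (case pstep A cs (pconf_at A x cs t) of None \<Rightarrow> pconf_at A x cs t | Some c \<Rightarrow> c)"

definition bits_used :: "pconf \<Rightarrow> nat" where
  "bits_used c = snd (snd (snd c))"

definition paccepts :: "ptm \<Rightarrow> bool list \<Rightarrow> (nat \<Rightarrow> bool) \<Rightarrow> bool" where
  "paccepts A x cs \<longleftrightarrow> (\<exists>t. phalted A cs (pconf_at A x cs t) \<and> fst (pconf_at A x cs t) = pacc A)"

definition acc_prob :: "ptm \<Rightarrow> bool list \<Rightarrow> real" where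
  "acc_prob A x =
     (let N = (LEAST N. \<forall>cs t. bits_used (pconf_at A x cs t) \<le> N)
      in real (card {r :: bool list. length r = N \<and> paccepts A x (\<lambda>i. i < N \<and> r ! i)}) / 2 ^ N)"

definition poly_time_ptm :: "ptm \<Rightarrow> bool" where
  "poly_time_ptm A \<longleftrightarrow> (\<exists>k. \<forall>x cs. phalted A cs (pconf_at A x cs (length x ^ k + k)))"

definition log_random_bits :: "ptm \<Rightarrow> bool" where
  "log_random_bits A \<longleftrightarrow>
     (\<exists>c::real. \<forall>x cs t. real (bits_used (pconf_at A x cs t)) \<le> c * log 2 (real (length x) + 2))"

definition bpp_accepts :: "ptm \<Rightarrow> bool list set \<Rightarrow> bool" where
  "bpp_accepts A L \<longleftrightarrow> (\<forall>x. (x \<in> L \<longrightarrow> acc_prob A x \<ge> 2/3) \<and> (x \<notin> L \<longrightarrow> acc_prob A x \<le> 1/3))"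

end

theory Submission
  imports Defs
begin

text \<open>
  Suppose A accepts the language with O(log n) random bits.  A deterministic single-tape machine M
  can run A on all polynomially many random strings and take the majority vote, so M decides the
  same language in polynomial time.  An encoding of M, padded with ones until the counter of the
  diagonal machine no longer overflows, then belongs to the language iff M rejects it, a
  contradiction.

  M has to be produced as an explicit transition table.  It enumerates the strings r of length L,
  starting with L = 0, as a binary counter; when a run of A asks for more than L bits, it restarts
  the enumeration with L + 1.  The quantity 2^L + val r increases with every run, which bounds the
  number of runs, and at the end L is the number of bits that the acceptance probability refers to.
  The outcome of the vote is kept in unary, with its sign in the state.  Between two steps of A
  all bookkeeping is done by finite-state transducers that sweep once over the visited part of the
  tape.
\<close>

section \<open>Machines over arbitrary finite alphabets\<close>

text \<open>Logarithmically many random bits are what keeps 2^L polynomial, and with it both the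
  number of runs and the length of the unary vote. That bound enters only the running time: its
  constant is an arbitrary real, and finding L on demand spares M any arithmetic with it. M needs no
  clock either, since A halts by itself on every coin sequence. The error bounds 2/3 and 1/3 keep
  the final vote away from zero, so the sign attached to a zero vote may be arbitrary. The language
  speaks about transition lists with numbered states and symbols. To design M with structured states
  and cells of several tracks, tables over arbitrary finite sets are first translated into that
  format, step for step. The later lemmas then follow one pattern: a sweep is computed on the list
  of visited cells, lifted to the tape with a time bound, and read as an operation on the simulated
  configuration, the random string and the vote.\<close>

type_synonym ('q, 'a) table = "'q \<Rightarrow> 'a \<Rightarrow> ('q \<times> 'a \<times> dir) option"
type_synonym ('q, 'a) config = "'q \<times> (int \<Rightarrow> 'a) \<times> int"

fun mstep :: "('q, 'a) table \<Rightarrow> ('q, 'a) config \<Rightarrow> ('q, 'a) config option" where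
  "mstep \<delta> (q, tp, h) = (case \<delta> q (tp h) of None \<Rightarrow> None
     | Some (q', a, d) \<Rightarrow> Some (q', tp(h := a), move d h))"

inductive runs :: "('q, 'a) table \<Rightarrow> ('q, 'a) config \<Rightarrow> nat \<Rightarrow> ('q, 'a) config \<Rightarrow> bool"
  for \<delta> where
  runs_refl: "runs \<delta> c 0 c"
| runs_step: "runs \<delta> c t c' \<Longrightarrow> mstep \<delta> c' = Some c'' \<Longrightarrow> runs \<delta> c (Suc t) c''"

lemma runs_trans: "runs \<delta> c' s c'' \<Longrightarrow> runs \<delta> c t c' \<Longrightarrow> runs \<delta> c (t + s) c''"
  by (induction rule: runs.induct) (auto intro: runs.intros)

text \<open>Upper bounds compose more easily than exact times. Exactness is recovered at the end: a
  halted configuration of the numbered machine persists, so any \<open>t\<close> below the bound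
  suffices.\<close>

definition reaches :: "('q, 'a) table \<Rightarrow> ('q, 'a) config \<Rightarrow> nat \<Rightarrow> ('q, 'a) config \<Rightarrow> bool" where
  "reaches \<delta> c B c' \<longleftrightarrow> (\<exists>t\<le>B. runs \<delta> c t c')"

lemma reaches_refl: "reaches \<delta> c B c"
  unfolding reaches_def by (intro exI[of _ 0]) (simp add: runs_refl)

lemma reaches_step: "mstep \<delta> c = Some c' \<Longrightarrow> reaches \<delta> c 1 c'"
  unfolding reaches_def by (intro exI[of _ 1]) (simp add: runs_step[OF runs_refl])

lemma reaches_mono: "reaches \<delta> c B c' \<Longrightarrow> B \<le> B' \<Longrightarrow> reaches \<delta> c B' c'"
  unfolding reaches_def by (meson order_trans)

lemma reaches_trans: "reaches \<delta> c B c' \<Longrightarrow> reaches \<delta> c' B' c'' \<Longrightarrow> reaches \<delta> c (B + B') c''"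
  unfolding reaches_def by (meson add_mono runs_trans)

lemma reaches_step_trans:
  "mstep \<delta> c = Some c' \<Longrightarrow> reaches \<delta> c' B c'' \<Longrightarrow> reaches \<delta> c (Suc B) c''"
  using reaches_trans[OF reaches_step] by (metis plus_1_eq_Suc)

lemma dconf_at_halted: "dhalted ts (dconf_at ts x t) \<Longrightarrow> dconf_at ts x (t + n) = dconf_at ts x t"
  by (induction n) (auto simp: dhalted_def)

lemma dconf_at_halted_le:
  assumes "dhalted ts (dconf_at ts x t)" "t \<le> t'"
  shows "dconf_at ts x t' = dconf_at ts x t"
  using dconf_at_halted[OF assms(1), of "t' - t"] assms(2) by simp

definition dir_code :: "dir \<Rightarrow> nat" where
  "dir_code d = (case d of Lt \<Rightarrow> 1 | Rt \<Rightarrow> 2 | St \<Rightarrow> 3)"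

lemma dir_of_code [simp]: "dir_of (dir_code d) = d" and dir_code_range: "dir_code d \<in> {1, 2, 3}"
  by (auto simp: dir_of_def dir_code_def split: dir.splits)

text \<open>The format prescribes number 1 for the initial state, the maximum for the accepting
  state, and 1, 2, 3 for blank, 0, 1; everything else is numbered injectively around these.
  \<open>Q\<close> and \<open>\<Gamma>\<close> are sets closed under \<open>\<delta>\<close> rather
  than types, because the types used later are infinite.\<close>

lemma machine_as_trans_list:
  fixes \<delta> :: "('q, 'a) table" and raw :: "nat \<Rightarrow> 'a"
  assumes fin: "finite Q" "finite \<Gamma>"
    and mem: "q0 \<in> Q" "qa \<in> Q" "q0 \<noteq> qa"
    and raw: "raw ` {1, 2, 3} \<subseteq> \<Gamma>" "inj_on raw {1, 2, 3}"
    and closed: "\<And>q a q' a' d. q \<in> Q \<Longrightarrow> a \<in> \<Gamma> \<Longrightarrow> \<delta> q a = Some (q', a', d) \<Longrightarrow> q' \<in> Q \<and> a' \<in> \<Gamma>"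
    and acc: "\<And>a. \<delta> qa a = None"
  shows "\<exists>ts. valid_tm ts \<and> distinct ts \<and>
    (\<forall>x t c. runs \<delta> (q0, raw \<circ> init_tape x, 0) t c \<longrightarrow> mstep \<delta> c = None \<longrightarrow>
       dhalted ts (dconf_at ts x t) \<and> (fst (dconf_at ts x t) = tm_acc ts \<longleftrightarrow> fst c = qa))"
proof -
  obtain e n where e: "inj_on e Q" "e ` Q = {i::nat. i < n}"
    using finite_imp_inj_to_nat_seg[OF fin(1)] by metis
  obtain e' and n' :: nat where e': "inj_on e' \<Gamma>" "e' ` \<Gamma> = {i::nat. i < n'}"
    using finite_imp_inj_to_nat_seg[OF fin(2)] by metis
  \<comment> \<open>The ordinary states occupy 2 to \<open>n + 1\<close>, between the initial state
    at 1 and the accepting state at \<open>n + 2\<close>. The shift by 4 in \<open>g\<close> avoids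
    the three prescribed symbols.\<close>
  define f where "f q = (if q = q0 then 1 else if q = qa then n + 2 else e q + 2)" for q
  define g where "g a = (if a = raw 1 then 1 else if a = raw 2 then 2 else
    if a = raw 3 then 3 else e' a + 4)" for a
  have e_less: "e q < n" if "q \<in> Q" for q using e(2) that by blast
  have f_inj: "f q = f q' \<longleftrightarrow> q = q'" if "q \<in> Q" "q' \<in> Q" for q q'
    using that e_less[OF that(1)] e_less[OF that(2)] inj_onD[OF e(1)] mem(3)
    by (auto simp: f_def split: if_splits)
  have f_ge: "1 \<le> f q" for q by (simp add: f_def)
  have f_le: "f q \<le> f qa" if "q \<in> Q" for q
    using e_less[OF that] mem(3) by (auto simp: f_def)
  have raw_neq: "raw 1 \<noteq> raw 2" "raw 1 \<noteq> raw 3" "raw 2 \<noteq> raw 3"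
    using raw(2) by (auto simp: inj_on_def)
  have g_inj: "g a = g a' \<longleftrightarrow> a = a'" if "a \<in> \<Gamma>" "a' \<in> \<Gamma>" for a a'
    using that inj_onD[OF e'(1)] by (auto simp: g_def split: if_splits)
  have g_ge: "1 \<le> g a" for a by (simp add: g_def)
  have g_raw: "g (raw j) = j" if "j \<in> {1, 2, 3}" for j
    using that raw_neq by (auto simp: g_def)
  (* The dummy transitions out of the accepting state are never executed; they make its number
     occur in the list, so that it is the maximum. *)
  define \<delta>' where "\<delta>' q a = (if q = qa then Some (qa, a, St) else \<delta> q a)" for q a
  have closed': "q' \<in> Q \<and> a' \<in> \<Gamma>"
    if "q \<in> Q" "a \<in> \<Gamma>" "\<delta>' q a = Some (q', a', d)" for q a q' a' d
    using that closed[OF that(1,2)] mem by (auto simp: \<delta>'_def split: if_splits)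
  define tr where "tr q a = (case the (\<delta>' q a) of (q', a', d) \<Rightarrow>
    (f q, g a, f q', g a', dir_code d))" for q a
  define D where "D = {(q, a). q \<in> Q \<and> a \<in> \<Gamma> \<and> \<delta>' q a \<noteq> None}"
  have "finite D" by (rule finite_subset[of _ "Q \<times> \<Gamma>"]) (auto simp: D_def fin)
  then have "finite ((\<lambda>(q, a). tr q a) ` D)" by simp
  then obtain ts where ts: "set ts = (\<lambda>(q, a). tr q a) ` D" "distinct ts"
    using finite_distinct_list by metis
  have tr_in: "(f q, g a, f q', g a', dir_code d) \<in> set ts"
    if "q \<in> Q" "a \<in> \<Gamma>" "\<delta>' q a = Some (q', a', d)" for q a q' a' d
    using that unfolding ts(1) D_def tr_def by force
  have ts_E: "\<exists>q a q' a' d. tup = (f q, g a, f q', g a', dir_code d) \<and>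
      q \<in> Q \<and> a \<in> \<Gamma> \<and> \<delta>' q a = Some (q', a', d)" if "tup \<in> set ts" for tup
    using that unfolding ts(1) D_def tr_def by force
  have inj: "inj_on (\<lambda>(i,j,k,l,m). (i,j)) (set ts)"
  proof (rule inj_onI)
    fix t1 t2 assume t: "t1 \<in> set ts" "t2 \<in> set ts"
      and eq: "(case t1 of (i,j,k,l,m) \<Rightarrow> (i,j)) = (case t2 of (i,j,k,l,m) \<Rightarrow> (i,j))"
    obtain q a q' a' d where 1: "t1 = (f q, g a, f q', g a', dir_code d)"
      "q \<in> Q" "a \<in> \<Gamma>" "\<delta>' q a = Some (q', a', d)" using ts_E[OF t(1)] by blast
    obtain p b p' b' d' where 2: "t2 = (f p, g b, f p', g b', dir_code d')"
      "p \<in> Q" "b \<in> \<Gamma>" "\<delta>' p b = Some (p', b', d')" using ts_E[OF t(2)] by blast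
    have "q = p" "a = b" using eq 1 2 f_inj g_inj by auto
    then show "t1 = t2" using 1 2 by auto
  qed
  have valid: "valid_tm ts"
    unfolding valid_tm_def
  proof (intro conjI ballI)
    fix tup assume "tup \<in> set ts"
    then obtain q a q' a' d where "tup = (f q, g a, f q', g a', dir_code d)" using ts_E by blast
    then show "case tup of (i,j,k,l,m) \<Rightarrow> i \<ge> 1 \<and> j \<ge> 1 \<and> k \<ge> 1 \<and> l \<ge> 1 \<and> m \<in> {1,2,3}"
      using f_ge g_ge dir_code_range by simp
  next
    show "distinct (map (\<lambda>(i,j,k,l,m). (i,j)) ts)" using ts(2) inj by (simp add: distinct_map)
  qed
  have acc_eq: "tm_acc ts = f qa"
    unfolding tm_acc_def
  proof (rule Max_eqI)
    fix y assume "y \<in> insert 1 ((\<lambda>(i,j,k,l,m). i) ` set ts \<union> (\<lambda>(i,j,k,l,m). k) ` set ts)"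
    then consider "y = 1" | tup where "tup \<in> set ts" "y = (case tup of (i,j,k,l,m) \<Rightarrow> i)"
      | tup where "tup \<in> set ts" "y = (case tup of (i,j,k,l,m) \<Rightarrow> k)" by auto
    then show "y \<le> f qa"
    proof cases
      case 1 then show ?thesis using f_ge by simp
    next
      case 2
      obtain q a q' a' d where *: "tup = (f q, g a, f q', g a', dir_code d)" "q \<in> Q"
        using ts_E[OF 2(1)] by blast
      then show ?thesis using 2 f_le[of q] by simp
    next
      case 3
      obtain q a q' a' d where *: "tup = (f q, g a, f q', g a', dir_code d)"
        "q \<in> Q" "a \<in> \<Gamma>" "\<delta>' q a = Some (q', a', d)" using ts_E[OF 3(1)] by blast
      then show ?thesis using 3 f_le[of q'] closed'[OF *(2-4)] by simp
    qed
  next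
    have "raw 1 \<in> \<Gamma>" using raw by auto
    then have "(f qa, g (raw 1), f qa, g (raw 1), dir_code St) \<in> set ts"
      by (intro tr_in) (auto simp: mem \<delta>'_def)
    then have "f qa \<in> (\<lambda>(i,j,k,l,m). i) ` set ts" by force
    then show "f qa \<in> insert 1 ((\<lambda>(i,j,k,l,m). i) ` set ts \<union> (\<lambda>(i,j,k,l,m). k) ` set ts)" by blast
  qed simp
  have delta_some: "tm_delta ts (f q) (g a) = Some (f q', g a', d)"
    if "q \<in> Q" "a \<in> \<Gamma>" "\<delta>' q a = Some (q', a', d)" for q a q' a' d
  proof -
    have "map_of (map (\<lambda>(i,j,k,l,m). ((i,j),(k,l,m))) ts) (f q, g a) = Some (f q', g a', dir_code d)"
    proof (rule map_of_is_SomeI)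
      have "map fst (map (\<lambda>(i,j,k,l,m). ((i,j),(k,l,m))) ts) = map (\<lambda>(i,j,k,l,m). (i,j)) ts" by auto
      then show "distinct (map fst (map (\<lambda>(i,j,k,l,m). ((i,j),(k,l,m))) ts))"
        using ts(2) inj by (simp only: distinct_map simp_thms)
      show "((f q, g a), f q', g a', dir_code d) \<in> set (map (\<lambda>(i,j,k,l,m). ((i,j),(k,l,m))) ts)"
        using tr_in[OF that] by force
    qed
    then show ?thesis by (simp add: tm_delta_def)
  qed
  have delta_none: "tm_delta ts (f q) (g a) = None"
    if "q \<in> Q" "a \<in> \<Gamma>" "\<delta>' q a = None" for q a
  proof -
    have "(f q, g a) \<notin> fst ` set (map (\<lambda>(i,j,k,l,m). ((i,j),(k,l,m))) ts)"
    proof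
      assume "(f q, g a) \<in> fst ` set (map (\<lambda>(i,j,k,l,m). ((i,j),(k,l,m))) ts)"
      then obtain k l m where "(f q, g a, k, l, m) \<in> set ts" by auto
      then obtain p b z where "f q = f p" "g a = g b" "p \<in> Q" "b \<in> \<Gamma>" "\<delta>' p b = Some z"
        using ts_E by blast
      then show False using that f_inj g_inj by auto
    qed
    then have "map_of (map (\<lambda>(i,j,k,l,m). ((i,j),(k,l,m))) ts) (f q, g a) = None"
      by (simp only: map_of_eq_None_iff not_False_eq_True)
    then show ?thesis by (simp add: tm_delta_def)
  qed
  \<comment> \<open>As an equation between options this transfers halting as well as moves, so both
    machines stop at the same time.\<close>
  have step: "dstep ts (f q, g \<circ> tp, h) = map_option (\<lambda>(q', tp', h'). (f q', g \<circ> tp', h')) (mstep \<delta> (q, tp, h))"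
    if "q \<in> Q" "range tp \<subseteq> \<Gamma>" for q tp h
  proof (cases "q = qa")
    case True then show ?thesis using acc by (simp add: dstep_def acc_eq)
  next
    case False
    have th: "tp h \<in> \<Gamma>" using that by auto
    have "f q \<noteq> f qa" using False f_inj that mem by blast
    moreover have "\<delta>' q (tp h) = \<delta> q (tp h)" using False by (simp add: \<delta>'_def)
    ultimately show ?thesis
      using delta_none[OF that(1) th] delta_some[OF that(1) th]
      by (auto simp: dstep_def acc_eq fun_upd_comp split: option.splits)
  qed
  have sim: "case c of (q, tp, h) \<Rightarrow> q \<in> Q \<and> range tp \<subseteq> \<Gamma> \<and> dconf_at ts x t = (f q, g \<circ> tp, h)"
    if "runs \<delta> (q0, raw \<circ> init_tape x, 0) t c" for x t c
    using that
  proof (induction "(q0, raw \<circ> init_tape x, 0::int)" t c rule: runs.induct)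
    case runs_refl
    have in3: "init_tape x i \<in> {1, 2, 3}" for i by (simp add: init_tape_def sym_of_def)
    have "g \<circ> (raw \<circ> init_tape x) = init_tape x"
    proof
      fix i show "(g \<circ> (raw \<circ> init_tape x)) i = init_tape x i"
        using g_raw[OF in3[of i]] by simp
    qed
    moreover have "range (raw \<circ> init_tape x) \<subseteq> \<Gamma>"
    proof
      fix y assume "y \<in> range (raw \<circ> init_tape x)"
      then obtain i where "y = raw (init_tape x i)" by auto
      then show "y \<in> \<Gamma>" using in3[of i] raw(1) by blast
    qed
    moreover have "f q0 = 1" by (simp add: f_def)
    ultimately show ?case using mem by simp
  next
    case (runs_step t c' c'')
    obtain q tp h where c': "c' = (q, tp, h)" by (cases c')
    have IH: "q \<in> Q" "range tp \<subseteq> \<Gamma>" "dconf_at ts x t = (f q, g \<circ> tp, h)"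
      using runs_step(2) c' by auto
    obtain q' a' d where s: "\<delta> q (tp h) = Some (q', a', d)" "c'' = (q', tp(h := a'), move d h)"
      using runs_step(3) c' by (auto split: option.splits)
    have cl: "q' \<in> Q" "a' \<in> \<Gamma>" using closed[OF IH(1) _ s(1)] IH(2) by auto
    have "dconf_at ts x (Suc t) = (f q', g \<circ> tp(h := a'), move d h)"
      using step[OF IH(1,2), of h] s IH(3) by simp
    moreover have "range (tp(h := a')) \<subseteq> \<Gamma>" using IH(2) cl(2) by auto
    ultimately show ?case using cl s(2) by simp
  qed
  show ?thesis
  proof (intro exI[of _ ts] conjI allI impI)
    fix x t c assume r: "runs \<delta> (q0, raw \<circ> init_tape x, 0) t c" and n: "mstep \<delta> c = None"
    obtain q tp h where c: "c = (q, tp, h)" by (cases c)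
    have s: "q \<in> Q" "range tp \<subseteq> \<Gamma>" "dconf_at ts x t = (f q, g \<circ> tp, h)"
      using sim[OF r] c by auto
    show "dhalted ts (dconf_at ts x t)"
      using step[OF s(1,2)] n c s(3) by (simp add: dhalted_def)
    show "(fst (dconf_at ts x t) = tm_acc ts) = (fst c = qa)"
      using s c f_inj[OF s(1) mem(2)] acc_eq by simp
  qed (use valid ts in auto)
qed

section \<open>Diagonalization\<close>

text \<open>A decoder that records the lengths of the nonempty zero blocks closed by a 1, with
  \<open>c\<close> zeros already read. Repeated ones yield nothing, so it is blind to the padding
  and to the double 1 between transitions.\<close>

fun zero_blocks :: "nat \<Rightarrow> bool list \<Rightarrow> nat list" where
  "zero_blocks c [] = []"
| "zero_blocks c (False # xs) = zero_blocks (Suc c) xs"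
| "zero_blocks c (True # xs) = (if c > 0 then [c] else []) @ zero_blocks 0 xs"

lemma zero_blocks_replicate:
  "zero_blocks c (replicate n False @ True # xs) =
     (if c + n > 0 then [c + n] else []) @ zero_blocks 0 xs"
  by (induction n arbitrary: c) auto

lemma zero_blocks_ones: "zero_blocks 0 (replicate p True @ xs) = zero_blocks 0 xs"
  by (induction p) auto

text \<open>Validity makes all five entries positive, so no block of a transition is empty and none
  gets lost.\<close>

lemma zero_blocks_code:
  assumes "valid_tm ts"
  shows "zero_blocks 0 (concat (map code_trans ts) @ xs) =
    concat (map (\<lambda>(i,j,k,l,m). [i,j,k,l,m]) ts) @ zero_blocks 0 xs"
proof -
  have "\<forall>(i,j,k,l,m)\<in>set ts. i \<ge> 1 \<and> j \<ge> 1 \<and> k \<ge> 1 \<and> l \<ge> 1 \<and> m \<ge> 1"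
    using assms by (fastforce simp: valid_tm_def)
  then show ?thesis
    by (induction ts) (auto simp: code_trans_def zero_blocks_replicate)
qed

text \<open>The remainder holds the block of the exponent, which is missing for exponent 0. Having
  at most one entry, it cannot be mistaken for a transition.\<close>

lemma quintuples_eq:
  "concat (map (\<lambda>(i,j,k,l,m). [i,j,k,l,m]) ts) @ us = concat (map (\<lambda>(i,j,k,l,m). [i,j,k,l,m]) ts') @ us'
    \<Longrightarrow> length us \<le> 1 \<Longrightarrow> length us' \<le> 1 \<Longrightarrow> ts = (ts' :: trans list) \<and> us = us'"
proof (induction ts arbitrary: ts')
  case Nil
  then show ?case by (cases ts') auto
next
  case (Cons tup ts)
  obtain i j k l m where tup: "tup = (i, j, k, l, m)" by (cases tup)
  show ?case
  proof (cases ts')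
    case Nil
    then show ?thesis using Cons.prems tup by (cases us') auto
  next
    case (Cons tup' ts'')
    then show ?thesis using Cons.prems Cons.IH[of ts''] tup by (cases tup') simp
  qed
qed

text \<open>Membership in \<open>Ld\<close> only asserts that some encoded pair behaves in a certain
  way; uniqueness turns this into a statement about the machine that was encoded.\<close>

lemma encodes_pair_unique:
  assumes "encodes_pair x ts k" "encodes_pair x ts' k'"
  shows "ts = ts' \<and> k = k'"
proof -
  have *: "zero_blocks 0 x = concat (map (\<lambda>(i,j,k,l,m). [i,j,k,l,m]) ts) @ (if k > 0 then [k] else [])"
    if "encodes_pair x ts k" for ts k
    using that zero_blocks_replicate[of 0 k "[]"]
    by (auto simp: encodes_pair_def zero_blocks_ones zero_blocks_code)
  have "ts = ts' \<and> (if k > 0 then [k] else []) = (if k' > 0 then [k'] else [])"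
    using *[OF assms(1)] *[OF assms(2)] by (intro quintuples_eq) auto
  then show ?thesis by (auto split: if_splits)
qed

lemma Ld_not_decided_in_poly_time:
  assumes "valid_tm ts" "distinct ts" "time_ok ts k0"
    and dec: "\<And>x. \<exists>t. dhalted ts (dconf_at ts x t) \<and> (fst (dconf_at ts x t) = tm_acc ts \<longleftrightarrow> x \<in> Ld)"
  shows False
proof -
  \<comment> \<open>\<open>time_exact\<close> demands the least exponent; \<open>k0\<close> shows
    that one exists.\<close>
  define k where "k = (LEAST k. time_ok ts k)"
  have exact: "time_exact ts k"
    unfolding time_exact_def k_def using assms(3) LeastI not_less_Least by metis
  \<comment> \<open>With length n at least \<open>k + 4\<close>, n^(k+1) is at least (k+4) n^k,
    hence at least n^k + k + 2. The 2 pays for the subtraction in the overflow bound of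
    \<open>Ld\<close>.\<close>
  define x where "x = replicate (k + 4) True @ concat (map code_trans ts) @ [True] @ replicate k False @ [True]"
  have enc: "encodes_pair x ts k"
    using assms exact unfolding encodes_pair_def x_def by blast
  have len: "length x \<ge> k + 4" by (simp add: x_def)
  let ?n = "length x"
  have "?n ^ k + k + 2 \<le> ?n ^ (k + 1)"
  proof -
    have "1 \<le> ?n ^ k" using len by (intro one_le_power) linarith
    then have "k + 2 \<le> (k + 3) * ?n ^ k" using mult_le_mono[of "k + 2" "k + 3" 1 "?n ^ k"] by simp
    then have "?n ^ k + k + 2 \<le> (k + 4) * ?n ^ k" by (simp add: algebra_simps)
    also have "\<dots> \<le> ?n * ?n ^ k" using len mult_le_mono1 by blast
    finally show ?thesis by simp
  qed
  then have le: "?n ^ k + k \<le> ?n ^ (k + 1) - 2" by simp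
  define c where "c = dconf_at ts x (?n ^ (k + 1) - 2)"
  have "dhalted ts (dconf_at ts x (?n ^ k + k))" using exact by (auto simp: time_exact_def time_ok_def)
  then have halt: "dhalted ts c" using dconf_at_halted_le[OF _ le] by (simp add: c_def)
  obtain t where t: "dhalted ts (dconf_at ts x t)" "fst (dconf_at ts x t) = tm_acc ts \<longleftrightarrow> x \<in> Ld"
    using dec by blast
  have "c = dconf_at ts x t"
    using dconf_at_halted_le[OF t(1)] dconf_at_halted_le[OF halt[unfolded c_def]]
    unfolding c_def by (metis linear)
  moreover have "x \<in> Ld \<longleftrightarrow> fst c \<noteq> tm_acc ts"
  proof
    assume "x \<in> Ld"
    then obtain ts' k' where *: "encodes_pair x ts' k'"
      "fst (dconf_at ts' x (?n ^ (k' + 1) - 2)) \<noteq> tm_acc ts'"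
      unfolding Ld_def Let_def by blast
    have "ts' = ts" "k' = k" using encodes_pair_unique[OF enc *(1)] by simp_all
    then show "fst c \<noteq> tm_acc ts" using *(2) by (simp only: c_def not_False_eq_True)
  next
    assume "fst c \<noteq> tm_acc ts"
    then show "x \<in> Ld" unfolding Ld_def Let_def using enc halt c_def by blast
  qed
  ultimately show False using t(2) by simp
qed

section \<open>The derandomizing machine\<close>

record cell =
  inp :: nat
  wrk :: nat
  here :: bool
  home :: bool
  rbit :: "(bool \<times> bool) option"
  tally :: bool

definition fresh_cell :: "nat \<Rightarrow> cell" where
  "fresh_cell a = \<lparr>inp = a, wrk = a, here = False, home = False, rbit = None, tally = False\<rparr>"

abbreviation blank_cell :: cell where
  "blank_cell \<equiv> fresh_cell 1"

text \<open>Mapping the blank to \<open>None\<close> makes the input exactly the initially visited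
  interval, whose ends a sweep can detect.\<close>

definition raw_cell :: "nat \<Rightarrow> cell option" where
  "raw_cell a = (if a = 1 then None else Some (fresh_cell a))"

text \<open>On the tape of the machine, \<open>None\<close> marks the cells outside the visited interval.  In a cell,
  \<open>inp\<close> keeps the input and \<open>wrk\<close> is the tape of the simulated machine; \<open>here\<close> remembers the head
  position during a sweep and \<open>home\<close> the position 0.  The entries \<open>rbit\<close>, read from left to
  right, form the current random string, each bit with a flag telling whether it has been consumed.
  The number of cells with \<open>tally\<close> is the absolute value of the vote.

  The last boolean of \<open>Sim\<close> and \<open>Exec\<close> is the sign of the vote.  \<open>Fetch q s g\<close> looks for the next
  unused bit, which is \<open>g\<close> once found.  \<open>Vote w s carry done\<close> resets the work tape, increments the
  random string and casts the vote \<open>w\<close>; if \<open>w\<close> differs from the sign, a tally mark has to be erased,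
  and \<open>done\<close> records that this has happened.  \<open>GoLeft w\<close> precedes the sweep \<open>w\<close>, and
  \<open>Back t\<close> returns to the cell marked \<open>here\<close> and continues in \<open>t\<close>.\<close>

datatype sweep = Fetch nat bool "bool option" | Vote bool bool bool bool | Restart

datatype state = Start | Sim nat bool | Exec nat bool bool
  | GoLeft sweep | Sweep sweep | Back state | Acc | Rej

text \<open>The random string has its least significant bit on the left, so a sweep to the right can
  propagate the carry. Copying \<open>home\<close> into \<open>here\<close> sends the subsequent
  \<open>Back\<close> to position 0, where the next run starts.\<close>

fun trans_cell :: "sweep \<Rightarrow> cell \<Rightarrow> sweep \<times> cell" where
  "trans_cell (Fetch q s g) c = (case (g, rbit c) of
     (None, Some (b, False)) \<Rightarrow> (Fetch q s (Some b), c\<lparr>rbit := Some (b, True)\<rparr>)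
   | _ \<Rightarrow> (Fetch q s g, c))"
| "trans_cell (Vote w s carry done) c =
     (let rm = (s \<noteq> w \<and> \<not> done \<and> tally c);
          c' = c\<lparr>wrk := inp c, here := home c, tally := (tally c \<and> \<not> rm)\<rparr>
      in case rbit c of None \<Rightarrow> (Vote w s carry (done \<or> rm), c')
         | Some (b, _) \<Rightarrow> (Vote w s (carry \<and> b) (done \<or> rm), c'\<lparr>rbit := Some (b \<noteq> carry, False)\<rparr>))"
| "trans_cell Restart c = (Restart, c\<lparr>wrk := inp c, here := home c, tally := False,
     rbit := map_option (\<lambda>_. (False, False)) (rbit c)\<rparr>)"

text \<open>Beyond the right end there is room for a new cell holding a random bit or a tally mark.
  A carry out of the last bit means that all strings of the current length have voted. Without
  \<open>done\<close>, either the signs agreed or there was no mark to erase, so the new sign is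
  \<open>w\<close>.\<close>

fun finish :: "sweep \<Rightarrow> state \<times> cell option \<times> dir" where
  "finish (Fetch q s (Some b)) = (Back (Exec q b s), None, Lt)"
| "finish (Fetch q s None) = (GoLeft Restart, Some (blank_cell\<lparr>rbit := Some (False, False)\<rparr>), St)"
| "finish (Vote w s carry done) =
     (if carry then (if (if done then s else w) then Acc else Rej, None, St)
      else if done then (Back (Sim 1 s), None, Lt)
      else (Back (Sim 1 w), Some (blank_cell\<lparr>tally := True\<rparr>), St))"
| "finish Restart = (Back (Sim 1 True), None, Lt)"

text \<open>In a coin state that admits no transition for either value of the bit, the simulation stops
  without fetching a bit.  Hence a bit is requested only if some random string really makes A
  consume it, and the final L is exactly the least bound in \<open>acc_prob\<close>.\<close>

definition stuck :: "ptm \<Rightarrow> nat \<Rightarrow> nat \<Rightarrow> bool" where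
  "stuck A q a \<longleftrightarrow> q = pacc A \<or>
     (pdelta A q a False = None \<and> (pcoin A q \<longrightarrow> pdelta A q a True = None))"

fun mdelta :: "ptm \<Rightarrow> (state, cell option) table" where
  "mdelta A Start x = Some (Sim 1 True,
     Some ((case x of None \<Rightarrow> blank_cell | Some c \<Rightarrow> c)\<lparr>home := True\<rparr>), St)"
| "mdelta A (Sim q s) None = Some (Sim q s, Some blank_cell, St)"
| "mdelta A (Sim q s) (Some c) =
     (if stuck A q (wrk c) then Some (GoLeft (Vote (q = pacc A) s True False), Some (c\<lparr>here := True\<rparr>), St)
      else if pcoin A q then Some (GoLeft (Fetch q s None), Some (c\<lparr>here := True\<rparr>), St)
      else Some (Exec q False s, Some c, St))"
| "mdelta A (Exec q b s) (Some c) = (case pdelta A q (wrk c) b of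
       None \<Rightarrow> Some (GoLeft (Vote False s True False), Some (c\<lparr>here := True\<rparr>), St)
     | Some (q', a, d) \<Rightarrow> Some (Sim q' s, Some (c\<lparr>wrk := a\<rparr>), d))"
| "mdelta A (Exec q b s) None = None"
| "mdelta A (GoLeft w) (Some c) = Some (GoLeft w, Some c, Lt)"
| "mdelta A (GoLeft w) None = Some (Sweep w, None, Rt)"
| "mdelta A (Sweep w) (Some c) = (case trans_cell w c of (w', c') \<Rightarrow> Some (Sweep w', Some c', Rt))"
| "mdelta A (Sweep w) None = Some (finish w)"
| "mdelta A (Back t) (Some c) =
     (if here c then Some (t, Some (c\<lparr>here := False\<rparr>), St) else Some (Back t, Some c, Lt))"
| "mdelta A (Back t) None = None"
| "mdelta A Acc x = None"
| "mdelta A Rej x = None"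

section \<open>Finite sets of states and cells closed under the table\<close>

definition work_symbols :: "ptm \<Rightarrow> nat set" where
  "work_symbols A = {1, 2, 3} \<union> {a. \<exists>q a0 b q' d. pdelta A q a0 b = Some (q', a, d)}"

definition sim_states :: "ptm \<Rightarrow> nat set" where
  "sim_states A = {1} \<union> {q'. \<exists>q a0 b a d. pdelta A q a0 b = Some (q', a, d)}"

lemma finite_pdelta_range:
  assumes "finite_ptm A"
  shows "finite {z. \<exists>q a b. pdelta A q a b = Some z}"
proof (rule finite_surj)
  show "finite {(q,a,b). pdelta A q a b \<noteq> None}" using assms by (simp add: finite_ptm_def)
  show "{z. \<exists>q a b. pdelta A q a b = Some z} \<subseteq>
      (\<lambda>(q,a,b). the (pdelta A q a b)) ` {(q,a,b). pdelta A q a b \<noteq> None}" by force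
qed

lemma finite_work_symbols: "finite_ptm A \<Longrightarrow> finite (work_symbols A)"
  unfolding work_symbols_def
  by (rule finite_UnI, simp, rule finite_surj[OF finite_pdelta_range, of A _ "\<lambda>(q,a,d). a"])
    (auto simp: image_iff Bex_def, blast)

lemma finite_sim_states: "finite_ptm A \<Longrightarrow> finite (sim_states A)"
  unfolding sim_states_def
  by (rule finite_UnI, simp, rule finite_surj[OF finite_pdelta_range, of A _ "\<lambda>(q,a,d). q"])
    (auto simp: image_iff Bex_def, blast)

fun legal_sweep :: "ptm \<Rightarrow> sweep \<Rightarrow> bool" where
  "legal_sweep A (Fetch q s g) = (q \<in> sim_states A)"
| "legal_sweep A (Vote w s c d) = True"
| "legal_sweep A Restart = True"

text \<open>\<open>state\<close> is recursive through \<open>Back\<close>; allowing only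
  \<open>Sim\<close> and \<open>Exec\<close> below \<open>Back\<close> is what makes the set of
  legal states finite.\<close>

fun legal_target :: "ptm \<Rightarrow> state \<Rightarrow> bool" where
  "legal_target A (Sim q s) = (q \<in> sim_states A)"
| "legal_target A (Exec q b s) = (q \<in> sim_states A)"
| "legal_target A _ = False"

fun legal_state :: "ptm \<Rightarrow> state \<Rightarrow> bool" where
  "legal_state A (GoLeft w) = legal_sweep A w"
| "legal_state A (Sweep w) = legal_sweep A w"
| "legal_state A (Back t) = legal_target A t"
| "legal_state A t = (t \<in> {Start, Acc, Rej} \<or> legal_target A t)"

definition cell_set :: "ptm \<Rightarrow> cell set" where
  "cell_set A = {c. inp c \<in> work_symbols A \<and> wrk c \<in> work_symbols A}"

lemma finite_legal_state:
  assumes "finite_ptm A"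
  shows "finite {t. legal_state A t}"
proof -
  note fin = finite_sim_states[OF assms]
  define W where "W = (\<lambda>(q, s, g). Fetch q s g) ` (sim_states A \<times> UNIV) \<union>
    (\<lambda>(w, s, c, d). Vote w s c d) ` UNIV \<union> {Restart}"
  define T where "T = (\<lambda>(q, s). Sim q s) ` (sim_states A \<times> UNIV) \<union>
    (\<lambda>(q, b, s). Exec q b s) ` (sim_states A \<times> UNIV)"
  have W: "w \<in> W" if "legal_sweep A w" for w
  proof (cases w)
    case (Fetch q s g)
    then have "w \<in> (\<lambda>(q, s, g). Fetch q s g) ` (sim_states A \<times> UNIV)"
      using that by (intro image_eqI[of _ _ "(q, s, g)"]) simp_all
    then show ?thesis by (simp add: W_def)
  next
    case (Vote w' s c d)
    then have "w \<in> (\<lambda>(w, s, c, d). Vote w s c d) ` UNIV"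
      by (intro image_eqI[of _ _ "(w', s, c, d)"]) simp_all
    then show ?thesis by (simp add: W_def)
  qed (simp add: W_def)
  have T: "t \<in> T" if "legal_target A t" for t
  proof (cases t)
    case (Sim q s)
    then have "t \<in> (\<lambda>(q, s). Sim q s) ` (sim_states A \<times> UNIV)"
      using that by (intro image_eqI[of _ _ "(q, s)"]) simp_all
    then show ?thesis by (simp add: T_def)
  next
    case (Exec q b s)
    then have "t \<in> (\<lambda>(q, b, s). Exec q b s) ` (sim_states A \<times> UNIV)"
      using that by (intro image_eqI[of _ _ "(q, b, s)"]) simp_all
    then show ?thesis by (simp add: T_def)
  qed (use that in simp_all)
  show ?thesis
  proof (rule finite_subset)
    show "finite ({Start, Acc, Rej} \<union> T \<union> Back ` T \<union> GoLeft ` W \<union> Sweep ` W)"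
      using fin by (simp add: W_def T_def)
    show "{t. legal_state A t} \<subseteq> {Start, Acc, Rej} \<union> T \<union> Back ` T \<union> GoLeft ` W \<union> Sweep ` W"
    proof
      fix t assume "t \<in> {t. legal_state A t}"
      then have "t \<in> {Start, Acc, Rej} \<or> t \<in> T \<or> t \<in> Back ` T \<or> t \<in> GoLeft ` W \<or> t \<in> Sweep ` W"
        using T W by (cases t) auto
      then show "t \<in> {Start, Acc, Rej} \<union> T \<union> Back ` T \<union> GoLeft ` W \<union> Sweep ` W" by blast
    qed
  qed
qed

lemma finite_cell_set:
  assumes "finite_ptm A"
  shows "finite (cell_set A)"
proof (rule finite_surj)
  show "finite (work_symbols A \<times> work_symbols A \<times> (UNIV :: (bool \<times> bool \<times> (bool \<times> bool) option \<times> bool) set))"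
    using finite_work_symbols[OF assms] by simp
  show "cell_set A \<subseteq> (\<lambda>(i, w, h, g, r, t). \<lparr>inp = i, wrk = w, here = h, home = g, rbit = r, tally = t\<rparr>) `
      (work_symbols A \<times> work_symbols A \<times> UNIV)"
  proof
    fix c assume "c \<in> cell_set A"
    then show "c \<in> (\<lambda>(i, w, h, g, r, t). \<lparr>inp = i, wrk = w, here = h, home = g, rbit = r, tally = t\<rparr>) `
      (work_symbols A \<times> work_symbols A \<times> UNIV)"
      by (intro image_eqI[of _ _ "(inp c, wrk c, here c, home c, rbit c, tally c)"])
        (auto simp: cell_set_def)
  qed
qed

lemma trans_cell_closed:
  assumes "legal_sweep A w" "c \<in> cell_set A"
  shows "legal_sweep A (fst (trans_cell w c)) \<and> snd (trans_cell w c) \<in> cell_set A"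
  using assms by (cases w) (auto simp: cell_set_def Let_def split: option.split bool.split)

lemma one_in_sim_states: "1 \<in> sim_states A" and one_in_work_symbols: "1 \<in> work_symbols A"
  by (auto simp: sim_states_def work_symbols_def)

lemma finish_closed:
  assumes "legal_sweep A w"
  shows "legal_state A (fst (finish w)) \<and> fst (snd (finish w)) \<in> insert None (Some ` cell_set A)"
  using assms one_in_sim_states one_in_work_symbols by (cases w rule: finish.cases)
    (auto simp: cell_set_def Let_def fresh_cell_def)

lemma mdelta_closed:
  assumes "legal_state A t" "x \<in> insert None (Some ` cell_set A)" "mdelta A t x = Some (t', x', d)"
  shows "legal_state A t' \<and> x' \<in> insert None (Some ` cell_set A)"
proof -
  have blank: "blank_cell \<in> cell_set A" "blank_cell\<lparr>home := True\<rparr> \<in> cell_set A"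
    using one_in_work_symbols by (auto simp: cell_set_def fresh_cell_def)
  have legal_target: "legal_state A u" if "legal_target A u" for u using that by (cases u) auto
  have range: "q' \<in> sim_states A" "a' \<in> work_symbols A"
    if "pdelta A q a b = Some (q', a', d)" for q a b q' a' d
    using that by (auto simp: sim_states_def work_symbols_def)
  consider c where "x = Some c" "c \<in> cell_set A" | "x = None" using assms(2) by auto
  then show ?thesis
  proof cases
    case 1
    have upd: "c\<lparr>here := v\<rparr> \<in> cell_set A" "c\<lparr>home := v\<rparr> \<in> cell_set A"
      "a \<in> work_symbols A \<Longrightarrow> c\<lparr>wrk := a\<rparr> \<in> cell_set A" for v a
      using 1 by (auto simp: cell_set_def)
    show ?thesis
    proof (cases t)
      case (Sweep w)
      then show ?thesis using trans_cell_closed[of A w c] assms 1 by (auto split: prod.splits)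
    next
      case (Exec q b s)
      then show ?thesis using assms 1 upd range by (auto split: option.splits)
    next
      case (Back u)
      then show ?thesis using assms 1 upd legal_target by (auto split: if_splits)
    qed (use assms 1 upd one_in_sim_states in \<open>auto split: if_splits\<close>)
  next
    case 2
    show ?thesis
    proof (cases t)
      case (Sweep w)
      then show ?thesis using finish_closed[of A w] assms 2 by auto
    qed (use 2 assms blank one_in_sim_states in \<open>auto split: if_splits\<close>)
  qed
qed

section \<open>Sweeps over the tape\<close>

text \<open>With default \<open>None\<close>, \<open>1\<close> or \<open>False\<close> this
  describes the tape of the machine, a tape of \<open>A\<close>, or a set of marked positions, all
  read off one list of cells.\<close>

definition segtape :: "'a \<Rightarrow> int \<Rightarrow> 'a list \<Rightarrow> int \<Rightarrow> 'a" where
  "segtape d lo xs i = (if lo \<le> i \<and> i < lo + int (length xs) then xs ! nat (i - lo) else d)"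

lemma segtape_nth: "j < length xs \<Longrightarrow> segtape d lo xs (lo + int j) = xs ! j"
  by (simp add: segtape_def)

lemma segtape_outside: "i < lo \<or> lo + int (length xs) \<le> i \<Longrightarrow> segtape d lo xs i = d"
  by (auto simp: segtape_def)

lemma segtape_update:
  "j < length xs \<Longrightarrow> (segtape d lo xs)(lo + int j := a) = segtape d lo (xs[j := a])"
  by (auto simp: segtape_def fun_eq_iff nth_list_update nat_eq_iff)

lemma segtape_snoc:
  "(segtape d lo xs)(lo + int (length xs) := a) = segtape d lo (xs @ [a])"
  by (auto simp: segtape_def fun_eq_iff nth_append)

lemma segtape_cons:
  "(segtape d lo xs)(lo - 1 := a) = segtape d (lo - 1) (a # xs)"
proof
  fix i
  have "lo \<le> i \<Longrightarrow> nat (i - (lo - 1)) = Suc (nat (i - lo))" by linarith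
  then show "((segtape d lo xs)(lo - 1 := a)) i = segtape d (lo - 1) (a # xs) i"
    by (auto simp: segtape_def)
qed

text \<open>Growing the visited interval by a cell with default entries is invisible in the decoded
  tapes.\<close>

lemma segtape_snoc_default: "segtape d lo (xs @ [d]) = segtape d lo xs"
  unfolding segtape_snoc[symmetric] by (simp add: fun_upd_idem_iff segtape_outside)

lemma segtape_cons_default: "segtape d (lo - 1) (d # xs) = segtape d lo xs"
  unfolding segtape_cons[symmetric] by (simp add: fun_upd_idem_iff segtape_outside)

lemma segtape_inside: "segtape d lo xs i \<noteq> d \<Longrightarrow> lo \<le> i \<and> i < lo + int (length xs)"
  by (auto simp: segtape_def split: if_splits)

abbreviation conf :: "state \<Rightarrow> int \<Rightarrow> cell list \<Rightarrow> int \<Rightarrow> (state, cell option) config" where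
  "conf t lo cs h \<equiv> (t, segtape None lo (map Some cs), h)"

fun sweep_list :: "sweep \<Rightarrow> cell list \<Rightarrow> sweep \<times> cell list" where
  "sweep_list w [] = (w, [])"
| "sweep_list w (c # cs) = (case trans_cell w c of (w1, c1) \<Rightarrow>
     (case sweep_list w1 cs of (w2, cs2) \<Rightarrow> (w2, c1 # cs2)))"

lemma length_sweep_list: "length (snd (sweep_list w cs)) = length cs"
  by (induction w cs rule: sweep_list.induct) (auto split: prod.splits)

lemma reaches_sweep:
  "sweep_list w cs = (w', cs') \<Longrightarrow>
   reaches (mdelta A) (conf (Sweep w) lo (ds @ cs) (lo + int (length ds))) (length cs)
     (conf (Sweep w') lo (ds @ cs') (lo + int (length ds + length cs)))"
proof (induction cs arbitrary: w ds cs')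
  case Nil
  then show ?case by (simp add: reaches_refl)
next
  case (Cons c cs)
  obtain w1 c1 where t: "trans_cell w c = (w1, c1)" by fastforce
  obtain cs1 where s: "sweep_list w1 cs = (w', cs1)" "cs' = c1 # cs1"
    using Cons.prems t by (auto split: prod.splits)
  have "mstep (mdelta A) (conf (Sweep w) lo (ds @ c # cs) (lo + int (length ds))) =
      Some (conf (Sweep w1) lo ((ds @ [c1]) @ cs) (lo + int (length (ds @ [c1]))))"
    using t by (simp add: segtape_nth segtape_update nth_append list_update_append move_def)
  then show ?case
    using reaches_step_trans[OF _ Cons.IH[OF s(1), of "ds @ [c1]"]] s(2) by simp
qed

text \<open>For \<open>j = 0\<close> the head already stands on the \<open>None\<close> left of the
  interval and only has to turn round; this turn is the extra step in \<open>Suc j\<close>.\<close>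

lemma reaches_go_left:
  "j \<le> length cs \<Longrightarrow>
   reaches (mdelta A) (conf (GoLeft w) lo cs (lo + int j - 1)) (Suc j) (conf (Sweep w) lo cs lo)"
proof (induction j)
  case 0
  have "mstep (mdelta A) (conf (GoLeft w) lo cs (lo - 1)) = Some (conf (Sweep w) lo cs lo)"
    by (simp add: segtape_outside move_def fun_upd_idem_iff)
  then show ?case using reaches_step_trans[OF _ reaches_refl] by fastforce
next
  case (Suc j)
  have "mstep (mdelta A) (conf (GoLeft w) lo cs (lo + int j)) = Some (conf (GoLeft w) lo cs (lo + int j - 1))"
    using Suc.prems by (simp add: segtape_nth segtape_update move_def map_update[symmetric])
  then show ?case using reaches_step_trans[OF _ Suc.IH] Suc.prems by simp
qed

lemma reaches_pass:
  assumes "sweep_list w cs = (w', cs')" "lo \<le> h" "h < lo + int (length cs)"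
  shows "reaches (mdelta A) (conf (GoLeft w) lo cs h) (2 * length cs + 1)
    (conf (Sweep w') lo cs' (lo + int (length cs)))"
proof -
  obtain j where j: "h = lo + int j - 1" "j \<le> length cs" "j \<ge> 1"
    using assms(2,3) by (intro that[of "nat (h - lo + 1)"]) auto
  show ?thesis
    using reaches_mono[OF reaches_trans[OF reaches_go_left[OF j(2)] reaches_sweep[OF assms(1), of A lo "[]", simplified]]] j
    by simp
qed

definition unmark :: "cell \<Rightarrow> cell" where
  "unmark c = c\<lparr>here := False\<rparr>"

lemma unmark_simps [simp]:
  "inp (unmark c) = inp c" "wrk (unmark c) = wrk c" "home (unmark c) = home c"
  "rbit (unmark c) = rbit c" "tally (unmark c) = tally c" "here (unmark c) = False"
  by (simp_all add: unmark_def)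

lemma reaches_back:
  assumes here: "segtape False lo (map here cs) = (\<lambda>i. i = p)" and "p \<le> h" "h < lo + int (length cs)"
  shows "reaches (mdelta A) (conf (Back t) lo cs h) (Suc (nat (h - p))) (conf t lo (map unmark cs) p)"
  using assms(2,3)
proof (induction "nat (h - p)" arbitrary: h)
  have p: "lo \<le> p" "p < lo + int (length cs)"
    using segtape_inside[of False lo "map here cs" p] here by auto
  have here_nth: "here (cs ! j) \<longleftrightarrow> lo + int j = p" if "j < length cs" for j
    using fun_cong[OF here, of "lo + int j"] that by (simp add: segtape_nth)
  {
    case 0
    then have h: "h = p" by simp
    obtain j where j: "p = lo + int j" "j < length cs" using p by (intro that[of "nat (p - lo)"]) auto
    \<comment> \<open>Cell \<open>j\<close> is the only marked one, so erasing its mark is the same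
      as unmarking every cell.\<close>
    have "cs[j := unmark (cs ! j)] = map unmark cs"
    proof (rule nth_equalityI)
      fix i assume i: "i < length (cs[j := unmark (cs ! j)])"
      then have "i \<noteq> j \<Longrightarrow> unmark (cs ! i) = cs ! i" using here_nth[of i] j by (simp add: unmark_def)
      then show "cs[j := unmark (cs ! j)] ! i = map unmark cs ! i" using i by (cases "i = j") auto
    qed simp
    then have "mstep (mdelta A) (conf (Back t) lo cs h) = Some (conf t lo (map unmark cs) p)"
      using h j here_nth[OF j(2)]
      by (simp add: segtape_nth segtape_update move_def unmark_def[symmetric] map_update[symmetric])
    then show ?case using reaches_step_trans[OF _ reaches_refl] h by fastforce
  next
    case (Suc n)
    obtain j where j: "h = lo + int j" "j < length cs" using p Suc.prems
      by (intro that[of "nat (h - lo)"]) auto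
    have "mstep (mdelta A) (conf (Back t) lo cs h) = Some (conf (Back t) lo cs (h - 1))"
      using j here_nth[OF j(2)] Suc.hyps(2)
      by (simp add: segtape_nth segtape_update move_def map_update[symmetric])
    moreover have "n = nat (h - 1 - p)" "p \<le> h - 1" "h - 1 < lo + int (length cs)"
      using Suc.hyps(2) Suc.prems by linarith+
    moreover have "Suc (nat (h - p)) = Suc (Suc (nat (h - 1 - p)))" using Suc.hyps(2) by linarith
    ultimately show ?case using reaches_step_trans[OF _ Suc.hyps(1)] by metis
  }
qed

section \<open>Effect of the sweeps on the contents of the cells\<close>

abbreviation rbits :: "cell list \<Rightarrow> (bool \<times> bool) list" where
  "rbits cs \<equiv> List.map_filter rbit cs"

lemma fetch_tracks:
  "sweep_list (Fetch q s g) cs = (w', cs') \<Longrightarrow>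
   map inp cs' = map inp cs \<and> map wrk cs' = map wrk cs \<and> map here cs' = map here cs \<and>
   map home cs' = map home cs \<and> map tally cs' = map tally cs"
proof (induction cs arbitrary: g cs')
  case (Cons c cs)
  obtain g1 c1 where t: "trans_cell (Fetch q s g) c = (Fetch q s g1, c1)"
    "inp c1 = inp c" "wrk c1 = wrk c" "here c1 = here c" "home c1 = home c" "tally c1 = tally c"
  proof (cases "g = None \<and> (\<exists>b. rbit c = Some (b, False))")
    case True
    then obtain b where "g = None" "rbit c = Some (b, False)" by blast
    then show ?thesis by (intro that[of "Some b" "c\<lparr>rbit := Some (b, True)\<rparr>"]) simp_all
  next
    case False
    then have "trans_cell (Fetch q s g) c = (Fetch q s g, c)"
      by (auto split: option.splits bool.splits)
    then show ?thesis by (intro that[of g c]) simp_all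
  qed
  obtain cs1 where s: "sweep_list (Fetch q s g1) cs = (w', cs1)" "cs' = c1 # cs1"
    using Cons.prems t(1) by (auto simp del: trans_cell.simps split: prod.splits)
  show ?case using Cons.IH[OF s(1)] s(2) t by simp
qed simp

lemma fetch_done: "sweep_list (Fetch q s (Some b)) cs = (Fetch q s (Some b), cs)"
  by (induction cs) auto

lemma fetch_none:
  "rbits cs = map (\<lambda>b. (b, True)) us \<Longrightarrow> sweep_list (Fetch q s None) cs = (Fetch q s None, cs)"
proof (induction cs arbitrary: us)
  case (Cons c cs)
  show ?case
  proof (cases "rbit c")
    case None
    then show ?thesis using Cons.prems Cons.IH[of us] by (simp add: map_filter_simps)
  next
    case (Some e)
    then obtain b us' where "us = b # us'" "e = (b, True)"
      using Cons.prems by (cases us) (auto simp: map_filter_simps)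
    then show ?thesis using Some Cons.prems Cons.IH[of us'] by (simp add: map_filter_simps)
  qed
qed simp

lemma fetch_some:
  "rbits cs = map (\<lambda>b. (b, True)) us @ (b, False) # rest \<Longrightarrow>
   \<exists>cs'. sweep_list (Fetch q s None) cs = (Fetch q s (Some b), cs') \<and>
     rbits cs' = map (\<lambda>b. (b, True)) us @ (b, True) # rest"
proof (induction cs arbitrary: us)
  case Nil
  then show ?case by (simp add: map_filter_simps)
next
  case (Cons c cs)
  show ?case
  proof (cases "rbit c")
    case None
    then show ?thesis using Cons by (fastforce simp: map_filter_simps)
  next
    case (Some e)
    show ?thesis
    proof (cases us)
      case Nil
      then show ?thesis using Some Cons.prems by (simp add: map_filter_simps fetch_done)
    next
      case (Cons b' us')
      then have "rbits cs = map (\<lambda>b. (b, True)) us' @ (b, False) # rest" "e = (b', True)"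
        using Some Cons.prems by (auto simp: map_filter_simps)
      then show ?thesis using Cons.IH[of us'] Some Cons by (fastforce simp: map_filter_simps)
    qed
  qed
qed

fun incr :: "bool \<Rightarrow> bool list \<Rightarrow> bool \<times> bool list" where
  "incr c [] = (c, [])"
| "incr c (b # r) = (case incr (c \<and> b) r of (c', r') \<Rightarrow> (c', (b \<noteq> c) # r'))"

fun bits_val :: "bool list \<Rightarrow> nat" where
  "bits_val [] = 0"
| "bits_val (b # r) = of_bool b + 2 * bits_val r"

text \<open>The outgoing carry has weight 2^L: without it the value has grown by one, and with it
  the string consisted of ones only and wraps to zeros.\<close>

lemma incr_val:
  "incr c r = (c', r') \<Longrightarrow>
     length r' = length r \<and> bits_val r' + of_bool c' * 2 ^ length r = bits_val r + of_bool c"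
proof (induction r arbitrary: c r')
  case (Cons b r)
  then obtain r1 where r1: "incr (c \<and> b) r = (c', r1)" "r' = (b \<noteq> c) # r1" by (auto split: prod.splits)
  then show ?case using Cons.IH[OF r1(1)] by (cases b; cases c; cases c') auto
qed simp

lemma bits_val_less: "bits_val r < 2 ^ length r"
  by (induction r) (auto simp: of_bool_def)

lemma bits_val_inj: "length r = length r' \<Longrightarrow> bits_val r = bits_val r' \<Longrightarrow> r = r'"
proof (induction r arbitrary: r')
  case (Cons b r)
  obtain b' r1 where r': "r' = b' # r1" using Cons.prems(1) by (cases r') auto
  have e: "of_bool b + 2 * bits_val r = of_bool b' + 2 * bits_val r1" using Cons.prems(2) r' by simp
  then have "b = b'" by (cases b; cases b') (simp_all, presburger+)
  then show ?case using e Cons.IH[of r1] Cons.prems(1) r' by simp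
qed simp

text \<open>For different signs, the number of marks plus \<open>done\<close> is conserved: at most
  one mark is erased, and \<open>done\<close> stays false only if there was none. The incoming flags
  are general for the induction; a sweep starts with \<open>True\<close> and
  \<open>False\<close>.\<close>

lemma vote_tracks:
  "sweep_list (Vote w s c d) cs = (w', cs') \<Longrightarrow> incr c (map fst (rbits cs)) = (c', r') \<Longrightarrow>
   map inp cs' = map inp cs \<and> map wrk cs' = map inp cs \<and> map here cs' = map home cs \<and>
   map home cs' = map home cs \<and> rbits cs' = map (\<lambda>b. (b, False)) r' \<and>
   (\<exists>d'. w' = Vote w s c' d' \<and>
     (s = w \<longrightarrow> d' = d \<and> length (filter tally cs') = length (filter tally cs)) \<and>
     (s \<noteq> w \<longrightarrow> length (filter tally cs') + of_bool d' = length (filter tally cs) + of_bool d \<and>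
        (d' \<or> length (filter tally cs') = 0)))"
proof (induction cs arbitrary: c d cs' r')
  case Nil
  then show ?case by (auto simp: map_filter_simps)
next
  case (Cons e cs)
  define rm where "rm = (s \<noteq> w \<and> \<not> d \<and> tally e)"
  define e0 where "e0 = e\<lparr>wrk := inp e, here := home e, tally := (tally e \<and> \<not> rm)\<rparr>"
  show ?case
  proof (cases "rbit e")
    case None
    then obtain cs1 where s: "sweep_list (Vote w s c (d \<or> rm)) cs = (w', cs1)" "cs' = e0 # cs1"
      using Cons.prems(1) by (auto simp: e0_def rm_def Let_def split: prod.splits)
    have "incr c (map fst (rbits cs)) = (c', r')" using Cons.prems(2) None by (simp add: map_filter_simps)
    note IH = Cons.IH[OF s(1) this]
    obtain d' where d': "w' = Vote w s c' d'"
      "s = w \<longrightarrow> d' = (d \<or> rm) \<and> length (filter tally cs1) = length (filter tally cs)"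
      "s \<noteq> w \<longrightarrow> length (filter tally cs1) + of_bool d' = length (filter tally cs) + of_bool (d \<or> rm) \<and>
        (d' \<or> length (filter tally cs1) = 0)"
      using IH by blast
    have cnt: "length (filter tally cs') = of_bool (tally e \<and> \<not> rm) + length (filter tally cs1)"
      using s(2) by (simp add: e0_def)
    have "s = w \<longrightarrow> d' = d \<and> length (filter tally cs') = length (filter tally (e # cs))"
      using d'(2) cnt by (simp add: rm_def)
    moreover have "s \<noteq> w \<longrightarrow> length (filter tally cs') + of_bool d' = length (filter tally (e # cs)) + of_bool d \<and>
        (d' \<or> length (filter tally cs') = 0)"
      using d'(3) cnt by (cases "tally e"; cases d; cases d') (simp_all add: rm_def)
    moreover have "map inp cs' = map inp (e # cs) \<and> map wrk cs' = map inp (e # cs) \<and>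
        map here cs' = map home (e # cs) \<and> map home cs' = map home (e # cs) \<and>
        rbits cs' = map (\<lambda>b. (b, False)) r'"
      using IH s(2) None by (simp add: map_filter_simps e0_def)
    ultimately show ?thesis using d'(1) by blast
  next
    case (Some z)
    then obtain b v where z: "rbit e = Some (b, v)" by (cases z) auto
    define e1 where "e1 = e0\<lparr>rbit := Some (b \<noteq> c, False)\<rparr>"
    obtain cs1 where s: "sweep_list (Vote w s (c \<and> b) (d \<or> rm)) cs = (w', cs1)" "cs' = e1 # cs1"
      using Cons.prems(1) z by (auto simp: e1_def e0_def rm_def Let_def split: prod.splits)
    obtain r1 where r1: "incr (c \<and> b) (map fst (rbits cs)) = (c', r1)" "r' = (b \<noteq> c) # r1"
      using Cons.prems(2) z by (auto simp: map_filter_simps split: prod.splits)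
    note IH = Cons.IH[OF s(1) r1(1)]
    obtain d' where d': "w' = Vote w s c' d'"
      "s = w \<longrightarrow> d' = (d \<or> rm) \<and> length (filter tally cs1) = length (filter tally cs)"
      "s \<noteq> w \<longrightarrow> length (filter tally cs1) + of_bool d' = length (filter tally cs) + of_bool (d \<or> rm) \<and>
        (d' \<or> length (filter tally cs1) = 0)"
      using IH by blast
    have cnt: "length (filter tally cs') = of_bool (tally e \<and> \<not> rm) + length (filter tally cs1)"
      using s(2) by (simp add: e1_def e0_def)
    have "s = w \<longrightarrow> d' = d \<and> length (filter tally cs') = length (filter tally (e # cs))"
      using d'(2) cnt by (simp add: rm_def)
    moreover have "s \<noteq> w \<longrightarrow> length (filter tally cs') + of_bool d' = length (filter tally (e # cs)) + of_bool d \<and>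
        (d' \<or> length (filter tally cs') = 0)"
      using d'(3) cnt by (cases "tally e"; cases d; cases d') (simp_all add: rm_def)
    moreover have "map inp cs' = map inp (e # cs) \<and> map wrk cs' = map inp (e # cs) \<and>
        map here cs' = map home (e # cs) \<and> map home cs' = map home (e # cs) \<and>
        rbits cs' = map (\<lambda>b. (b, False)) r'"
      using IH s(2) r1(2) z by (simp add: map_filter_simps e1_def e0_def)
    ultimately show ?thesis using d'(1) by blast
  qed
qed

lemma restart_tracks:
  "\<exists>cs'. sweep_list Restart cs = (Restart, cs') \<and>
   map inp cs' = map inp cs \<and> map wrk cs' = map inp cs \<and> map here cs' = map home cs \<and>
   map home cs' = map home cs \<and> rbits cs' = replicate (length (rbits cs)) (False, False) \<and>
   filter tally cs' = []"
  by (induction cs) (auto simp: map_filter_simps split: option.splits)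

section \<open>Simulating one step\<close>

lemma map_update_same: "j < length cs \<Longrightarrow> f c = f (cs ! j) \<Longrightarrow> map f (cs[j := c]) = map f cs"
  by (simp add: map_update list_update_same_conv)

lemma rbits_cong: "map rbit cs = map rbit cs' \<Longrightarrow> rbits cs = rbits cs'"
proof (induction cs arbitrary: cs')
  case (Cons c cs)
  then show ?case by (cases cs') (auto simp: map_filter_simps split: option.split)
qed simp

lemma count_cong: "map P xs = map P ys \<Longrightarrow> length (filter P xs) = length (filter P ys)"
proof (induction xs arbitrary: ys)
  case (Cons c xs)
  then show ?case by (cases ys) auto
qed simp

lemma rbits_append: "rbits (xs @ ys) = rbits xs @ rbits ys"
  by (induction xs) (auto simp: map_filter_simps split: option.split)

text \<open>The part of the invariant on which a restart relies; that sweep overwrites the work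
  tape, the head mark, the bits and the vote.\<close>

definition holds_input :: "bool list \<Rightarrow> int \<Rightarrow> cell list \<Rightarrow> bool" where
  "holds_input x lo cs \<longleftrightarrow> segtape 1 lo (map inp cs) = init_tape x \<and>
     segtape False lo (map home cs) = (\<lambda>i. i = 0)"

text \<open>\<open>H\<close> is empty during the simulation and a single position around a sweep.
  Consumed bits form a prefix of \<open>r\<close>, so the first unflagged bit is the next one to
  use.\<close>

definition represents where
  "represents x r u W H n lo cs \<longleftrightarrow> holds_input x lo cs \<and>
     segtape 1 lo (map wrk cs) = W \<and> segtape False lo (map here cs) = H \<and>
     rbits cs = map (\<lambda>b. (b, True)) (take u r) @ map (\<lambda>b. (b, False)) (drop u r) \<and>
     u \<le> length r \<and> length (filter tally cs) = n"

lemma represents_mark: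
  assumes "represents x r u W (\<lambda>i. False) n lo cs" "j < length cs"
  shows "represents x r u W (\<lambda>i. i = lo + int j) n lo (cs[j := (cs ! j)\<lparr>here := True\<rparr>])"
proof -
  let ?cs = "cs[j := (cs ! j)\<lparr>here := True\<rparr>]"
  have "map inp ?cs = map inp cs" "map wrk ?cs = map wrk cs" "map home ?cs = map home cs"
    "map rbit ?cs = map rbit cs" "map tally ?cs = map tally cs"
    using assms(2) by (simp_all add: map_update_same)
  moreover have "(\<lambda>i. False)(lo + int j := True) = (\<lambda>i. i = lo + int j)" by (auto simp: fun_eq_iff)
  then have "segtape False lo (map here ?cs) = (\<lambda>i. i = lo + int j)"
    using assms segtape_update[of j "map here cs" False lo True]
    by (simp add: map_update represents_def)
  ultimately show ?thesis
    using assms(1) rbits_cong[of ?cs cs] count_cong[of tally ?cs cs]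
    unfolding represents_def holds_input_def by simp
qed

lemma represents_unmark:
  assumes "represents x r u W H n lo cs"
  shows "represents x r u W (\<lambda>i. False) n lo (map unmark cs)"
proof -
  have "map inp (map unmark cs) = map inp cs" "map wrk (map unmark cs) = map wrk cs"
    "map home (map unmark cs) = map home cs" "map rbit (map unmark cs) = map rbit cs"
    "map tally (map unmark cs) = map tally cs"
    by (simp_all add: comp_def)
  moreover have "segtape False lo (map here (map unmark cs)) = (\<lambda>i. False)"
    by (auto simp: segtape_def fun_eq_iff)
  ultimately show ?thesis
    using assms rbits_cong[of "map unmark cs" cs] count_cong[of tally "map unmark cs" cs]
    unfolding represents_def holds_input_def by (simp del: map_map)
qed

lemma represents_write:
  assumes "represents x r u W H n lo cs" "j < length cs"
  shows "represents x r u (W(lo + int j := a)) H n lo (cs[j := (cs ! j)\<lparr>wrk := a\<rparr>])"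
proof -
  let ?cs = "cs[j := (cs ! j)\<lparr>wrk := a\<rparr>]"
  have "map inp ?cs = map inp cs" "map here ?cs = map here cs" "map home ?cs = map home cs"
    "map rbit ?cs = map rbit cs" "map tally ?cs = map tally cs"
    using assms(2) by (simp_all add: map_update_same)
  moreover have "segtape 1 lo (map wrk ?cs) = W(lo + int j := a)"
    using assms segtape_update[of j "map wrk cs" 1 lo a]
    by (auto simp: map_update represents_def)
  ultimately show ?thesis
    using assms(1) rbits_cong[of ?cs cs] count_cong[of tally ?cs cs]
    unfolding represents_def holds_input_def by simp
qed

lemma represents_snoc_blank: "represents x r u W H n lo cs \<Longrightarrow> represents x r u W H n lo (cs @ [blank_cell])"
  unfolding represents_def holds_input_def
  by (simp add: fresh_cell_def segtape_snoc_default rbits_append map_filter_simps)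

lemma represents_cons_blank: "represents x r u W H n lo cs \<Longrightarrow> represents x r u W H n (lo - 1) (blank_cell # cs)"
  unfolding represents_def holds_input_def
  by (simp add: fresh_cell_def segtape_cons_default map_filter_simps)

lemma represents_wrk: "represents x r u W H n lo cs \<Longrightarrow> j < length cs \<Longrightarrow> wrk (cs ! j) = W (lo + int j)"
  unfolding represents_def using segtape_nth[of j "map wrk cs" 1 lo] by auto

lemma holds_input_zero: "holds_input x lo cs \<Longrightarrow> lo \<le> 0 \<and> 0 < lo + int (length cs)"
  unfolding holds_input_def using segtape_inside[of False lo "map home cs" 0] by simp

lemma sim_enter_region:
  assumes "represents x r u W H n lo cs" "lo - 1 \<le> h" "h \<le> lo + int (length cs)"
  obtains lo' cs' where
    "reaches (mdelta A) (conf (Sim q s) lo cs h) 1 (conf (Sim q s) lo' cs' h)"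
    "represents x r u W H n lo' cs'" "lo' \<le> h" "h < lo' + int (length cs')" "length cs' \<le> Suc (length cs)"
proof -
  consider "lo \<le> h" "h < lo + int (length cs)" | "h = lo - 1" | "h = lo + int (length cs)"
    using assms(2,3) by linarith
  then show ?thesis
  proof cases
    case 1
    then show ?thesis using that[of lo cs] assms(1) by (simp add: reaches_refl)
  next
    case 2
    have "mstep (mdelta A) (conf (Sim q s) lo cs h) = Some (conf (Sim q s) (lo - 1) (blank_cell # cs) h)"
      using 2 segtape_cons[of None lo "map Some cs" "Some blank_cell"]
      by (simp add: segtape_outside move_def)
    from reaches_step[OF this] show ?thesis
      using 2 represents_cons_blank[OF assms(1)] by (intro that[of "lo - 1" "blank_cell # cs"]) simp_all
  next
    case 3
    have "mstep (mdelta A) (conf (Sim q s) lo cs h) = Some (conf (Sim q s) lo (cs @ [blank_cell]) h)"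
      using 3 segtape_snoc[of None lo "map Some cs" "Some blank_cell"]
      by (simp add: segtape_outside move_def)
    from reaches_step[OF this] show ?thesis
      using 3 represents_snoc_blank[OF assms(1)] by (intro that[of lo "cs @ [blank_cell]"]) simp_all
  qed
qed

text \<open>Runs are described for all coin sequences beginning with \<open>r\<close> at once: the
  bit bound in \<open>acc_prob\<close> ranges over all sequences, whereas acceptance is evaluated on
  finite strings padded with \<open>False\<close>.\<close>

definition ext :: "bool list \<Rightarrow> (nat \<Rightarrow> bool) \<Rightarrow> bool" where
  "ext r \<omega> \<longleftrightarrow> (\<forall>i<length r. \<omega> i = r ! i)"

lemma move_range: "lo \<le> h \<Longrightarrow> h < lo + int n \<Longrightarrow> lo - 1 \<le> move d h \<and> move d h \<le> lo + int n"
  by (cases d) (auto simp: move_def)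

text \<open>A simulated step ends in one of three ways: the simulated machine has halted, it has
  requested a random bit beyond the current bound, or it has moved on.\<close>

definition vote_begins where
  "vote_begins x r n s w B A c m \<longleftrightarrow> (\<exists>u W lo cs h.
     reaches (mdelta A) c B (conf (GoLeft (Vote w s True False)) lo cs h) \<and>
     represents x r u W (\<lambda>i. i = h) n lo cs \<and> lo \<le> h \<and> h < lo + int (length cs) \<and> length cs \<le> m)"

definition restart_begins where
  "restart_begins x r B A c m \<longleftrightarrow> (\<exists>lo cs h.
     reaches (mdelta A) c B (conf (GoLeft Restart) lo cs h) \<and>
     holds_input x lo cs \<and> length (rbits cs) = Suc (length r) \<and>
     lo \<le> h \<and> h < lo + int (length cs) \<and> length cs \<le> m)"

lemma vote_beginsI:
  "reaches (mdelta A) c B (conf (GoLeft (Vote w s True False)) lo cs h) \<Longrightarrow>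
   represents x r u W (\<lambda>i. i = h) n lo cs \<Longrightarrow> lo \<le> h \<Longrightarrow> h < lo + int (length cs) \<Longrightarrow>
   length cs \<le> m \<Longrightarrow> vote_begins x r n s w B A c m"
  unfolding vote_begins_def by blast

lemma vote_begins_trans:
  assumes "reaches (mdelta A) c B c'" "vote_begins x r n s w B' A c' m" "B + B' \<le> B''" "m \<le> m'"
  shows "vote_begins x r n s w B'' A c m'"
  using assms reaches_mono[OF reaches_trans[OF assms(1)] assms(3)]
  unfolding vote_begins_def by (meson order_trans)

lemma restart_begins_trans:
  assumes "reaches (mdelta A) c B c'" "restart_begins x r B' A c' m" "B + B' \<le> B''" "m \<le> m'"
  shows "restart_begins x r B'' A c m'"
  using assms reaches_mono[OF reaches_trans[OF assms(1)] assms(3)]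
  unfolding restart_begins_def by (meson order_trans)

lemma exec_step:
  assumes inv: "represents x r u W (\<lambda>i. False) n lo cs" and h: "lo \<le> h" "h < lo + int (length cs)"
  shows "case pdelta A q (W h) b of
      None \<Rightarrow> vote_begins x r n s False 1 A (conf (Exec q b s) lo cs h) (length cs)
    | Some (q', a, d) \<Rightarrow> \<exists>cs'.
        reaches (mdelta A) (conf (Exec q b s) lo cs h) 1 (conf (Sim q' s) lo cs' (move d h)) \<and>
        represents x r u (W(h := a)) (\<lambda>i. False) n lo cs' \<and> length cs' = length cs"
proof -
  obtain j where j: "h = lo + int j" "j < length cs" using h by (intro that[of "nat (h - lo)"]) auto
  note wrk = represents_wrk[OF inv j(2)]
  show ?thesis
  proof (cases "pdelta A q (W h) b")
    case None
    let ?cs = "cs[j := (cs ! j)\<lparr>here := True\<rparr>]"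
    have "mstep (mdelta A) (conf (Exec q b s) lo cs h) =
        Some (conf (GoLeft (Vote False s True False)) lo ?cs h)"
      using None j wrk by (simp add: segtape_nth segtape_update map_update move_def)
    from reaches_step[OF this] have "vote_begins x r n s False 1 A (conf (Exec q b s) lo cs h) (length cs)"
      by (rule vote_beginsI) (use represents_mark[OF inv j(2)] j h in auto)
    then show ?thesis using None by simp
  next
    case (Some z)
    obtain q' a d where z: "z = (q', a, d)" by (cases z)
    let ?cs = "cs[j := (cs ! j)\<lparr>wrk := a\<rparr>]"
    have "mstep (mdelta A) (conf (Exec q b s) lo cs h) = Some (conf (Sim q' s) lo ?cs (move d h))"
      using Some z j wrk by (simp add: segtape_nth segtape_update map_update)
    from reaches_step[OF this] show ?thesis
      using Some z represents_write[OF inv j(2), of a] j by auto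
  qed
qed

lemma fetch_bit:
  assumes inv: "represents x r u W (\<lambda>i. i = h) n lo cs" and h: "lo \<le> h" "h < lo + int (length cs)"
    and u: "u < length r"
  shows "\<exists>cs'. reaches (mdelta A) (conf (GoLeft (Fetch q s None)) lo cs h) (3 * length cs + 3)
      (conf (Exec q (r ! u) s) lo cs' h) \<and>
    represents x r (Suc u) W (\<lambda>i. False) n lo cs' \<and> length cs' = length cs"
proof -
  have "rbits cs = map (\<lambda>b. (b, True)) (take u r) @ (r ! u, False) # map (\<lambda>b. (b, False)) (drop (Suc u) r)"
    using inv u by (simp add: represents_def Cons_nth_drop_Suc[symmetric])
  from fetch_some[OF this] obtain cs1 where
    sweep: "sweep_list (Fetch q s None) cs = (Fetch q s (Some (r ! u)), cs1)" and
    bits: "rbits cs1 = map (\<lambda>b. (b, True)) (take u r) @ (r ! u, True) # map (\<lambda>b. (b, False)) (drop (Suc u) r)"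
    by blast
  note tracks = fetch_tracks[OF sweep]
  have len: "length cs1 = length cs" using length_sweep_list[of _ cs] sweep by (metis snd_conv)
  have "represents x r (Suc u) W (\<lambda>i. i = h) n lo cs1"
    using inv tracks bits u count_cong[of tally cs1 cs]
    by (simp add: represents_def holds_input_def take_Suc_conv_app_nth)
  note inv1 = this represents_unmark[OF this]
  have step: "mstep (mdelta A) (conf (Sweep (Fetch q s (Some (r ! u)))) lo cs1 (lo + int (length cs))) =
      Some (conf (Back (Exec q (r ! u) s)) lo cs1 (lo + int (length cs) - 1))"
    using len by (simp add: segtape_outside move_def fun_upd_idem_iff)
  have here: "segtape False lo (map here cs1) = (\<lambda>i. i = h)" using inv1(1) by (simp add: represents_def)
  have "reaches (mdelta A) (conf (Back (Exec q (r ! u) s)) lo cs1 (lo + int (length cs) - 1))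
      (Suc (nat (lo + int (length cs) - 1 - h))) (conf (Exec q (r ! u) s) lo (map unmark cs1) h)"
    using here h len by (intro reaches_back) auto
  from reaches_trans[OF reaches_pass[OF sweep h] reaches_step_trans[OF step this]]
  have "reaches (mdelta A) (conf (GoLeft (Fetch q s None)) lo cs h) (3 * length cs + 3)
      (conf (Exec q (r ! u) s) lo (map unmark cs1) h)"
    by (rule reaches_mono) (use h in linarith)
  moreover have "length (map unmark cs1) = length cs" using len by simp
  ultimately show ?thesis using inv1(2) by blast
qed

lemma fetch_fails:
  assumes inv: "represents x r (length r) W (\<lambda>i. i = h) n lo cs" and h: "lo \<le> h" "h < lo + int (length cs)"
  shows "restart_begins x r (2 * length cs + 2) A (conf (GoLeft (Fetch q s None)) lo cs h) (Suc (length cs))"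
proof -
  have "rbits cs = map (\<lambda>b. (b, True)) r" using inv by (simp add: represents_def)
  from fetch_none[OF this] have sweep: "sweep_list (Fetch q s None) cs = (Fetch q s None, cs)" .
  let ?e = "blank_cell\<lparr>rbit := Some (False, False)\<rparr>"
  have step: "mstep (mdelta A) (conf (Sweep (Fetch q s None)) lo cs (lo + int (length cs))) =
      Some (conf (GoLeft Restart) lo (cs @ [?e]) (lo + int (length cs)))"
    using segtape_snoc[of None lo "map Some cs" "Some ?e"] by (simp add: segtape_outside move_def)
  from reaches_trans[OF reaches_pass[OF sweep h] reaches_step[OF step]]
  have "reaches (mdelta A) (conf (GoLeft (Fetch q s None)) lo cs h) (2 * length cs + 2)
      (conf (GoLeft Restart) lo (cs @ [?e]) (lo + int (length cs)))"
    by (rule reaches_mono) simp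
  moreover have "holds_input x lo (cs @ [?e])"
    using inv unfolding represents_def holds_input_def by (simp add: fresh_cell_def segtape_snoc_default)
  moreover have "length (rbits (cs @ [?e])) = Suc (length r)"
    using inv by (simp add: represents_def rbits_append map_filter_simps)
  ultimately show ?thesis unfolding restart_begins_def using h
    by (intro exI[of _ lo] exI[of _ "cs @ [?e]"] exI[of _ "lo + int (length cs)"]) simp
qed

lemma sim_step:
  assumes inv: "represents x r u W (\<lambda>i. False) n lo cs" and h: "lo - 1 \<le> h" "h \<le> lo + int (length cs)"
  shows "(vote_begins x r n s (q = pacc A) (3 * length cs + 10) A (conf (Sim q s) lo cs h) (Suc (length cs)) \<and>
      (\<forall>\<omega>. ext r \<omega> \<longrightarrow> pstep A \<omega> (q, W, h, u) = None)) \<or>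
    (restart_begins x r (3 * length cs + 10) A (conf (Sim q s) lo cs h) (Suc (Suc (length cs))) \<and>
      (\<exists>\<omega> c. ext r \<omega> \<and> pstep A \<omega> (q, W, h, u) = Some c \<and> length r < bits_used c)) \<or>
    (\<exists>q' W' h' u' lo' cs'.
      reaches (mdelta A) (conf (Sim q s) lo cs h) (3 * length cs + 10) (conf (Sim q' s) lo' cs' h') \<and>
      (\<forall>\<omega>. ext r \<omega> \<longrightarrow> pstep A \<omega> (q, W, h, u) = Some (q', W', h', u')) \<and>
      represents x r u' W' (\<lambda>i. False) n lo' cs' \<and> lo' - 1 \<le> h' \<and> h' \<le> lo' + int (length cs') \<and>
      length cs' \<le> Suc (length cs))"
    (is "?V \<or> ?R \<or> ?S")
proof -
  obtain lo1 cs1 where r1: "reaches (mdelta A) (conf (Sim q s) lo cs h) 1 (conf (Sim q s) lo1 cs1 h)"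
    and inv1: "represents x r u W (\<lambda>i. False) n lo1 cs1"
    and h1: "lo1 \<le> h" "h < lo1 + int (length cs1)" and len1: "length cs1 \<le> Suc (length cs)"
    using sim_enter_region[OF inv h] by metis
  obtain j where j: "h = lo1 + int j" "j < length cs1" using h1 by (intro that[of "nat (h - lo1)"]) auto
  note wrk = represents_wrk[OF inv1 j(2)]
  let ?m = "cs1[j := (cs1 ! j)\<lparr>here := True\<rparr>]"
  have invm: "represents x r u W (\<lambda>i. i = h) n lo1 ?m" using represents_mark[OF inv1 j(2)] j by simp
  have u: "u \<le> length r" using inv by (simp add: represents_def)
  \<comment> \<open>Common end of the cases with and without a coin, once the bit \<open>b\<close>
    is known. One unit of the time bound is kept for the \<open>Exec\<close> step itself.\<close>
  have exec: ?thesis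
    if e: "reaches (mdelta A) (conf (Sim q s) lo cs h) (3 * length cs + 9) (conf (Exec q b s) lo1 cs2 h)"
      "represents x r u2 W (\<lambda>i. False) n lo1 cs2" "length cs2 = length cs1" "q \<noteq> pacc A"
      "\<And>\<omega>. ext r \<omega> \<Longrightarrow> pstep A \<omega> (q, W, h, u) =
         map_option (\<lambda>(q', a, d). (q', W(h := a), move d h, u2)) (pdelta A q (W h) b)"
    for b cs2 u2
  proof -
    have h2: "lo1 \<le> h" "h < lo1 + int (length cs2)" using h1 e(3) by auto
    note ex = exec_step[OF e(2) h2, where A = A and q = q and b = b and s = s]
    show ?thesis
    proof (cases "pdelta A q (W h) b")
      case None
      then have "vote_begins x r n s False 1 A (conf (Exec q b s) lo1 cs2 h) (length cs2)" using ex by simp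
      \<comment> \<open>The tape may already flag a bit as consumed although \<open>A\<close> stops
        without counting it. This is harmless, as \<open>vote_begins\<close> leaves the number of
        flagged bits open. The vote \<open>False\<close> fits because \<open>q\<close> is not
        accepting.\<close>
      from vote_begins_trans[OF e(1) this] have ?V using e None len1 by auto
      then show ?thesis by blast
    next
      case (Some z)
      obtain q' a d where z: "z = (q', a, d)" by (cases z)
      obtain cs3 where "reaches (mdelta A) (conf (Exec q b s) lo1 cs2 h) 1 (conf (Sim q' s) lo1 cs3 (move d h))"
        "represents x r u2 (W(h := a)) (\<lambda>i. False) n lo1 cs3" "length cs3 = length cs2"
        using ex Some z by auto
      moreover from reaches_trans[OF e(1) this(1)]
      have "reaches (mdelta A) (conf (Sim q s) lo cs h) (3 * length cs + 10) (conf (Sim q' s) lo1 cs3 (move d h))"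
        by (rule reaches_mono) simp
      moreover have "\<forall>\<omega>. ext r \<omega> \<longrightarrow> pstep A \<omega> (q, W, h, u) = Some (q', W(h := a), move d h, u2)"
        using e(5) Some z by simp
      moreover have "lo1 - 1 \<le> move d h \<and> move d h \<le> lo1 + int (length cs3)"
        using move_range[OF h1] e(3) calculation(3) by simp
      ultimately have ?S using len1 e(3) by (metis (no_types, lifting))
      then show ?thesis by blast
    qed
  qed
  consider "stuck A q (W h)" | "\<not> stuck A q (W h)" "pcoin A q" "u < length r"
    | "\<not> stuck A q (W h)" "pcoin A q" "u = length r" | "\<not> stuck A q (W h)" "\<not> pcoin A q"
    using u by linarith
  then show ?thesis
  proof cases
    case 1
    have "mstep (mdelta A) (conf (Sim q s) lo1 cs1 h) =
        Some (conf (GoLeft (Vote (q = pacc A) s True False)) lo1 ?m h)"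
      using 1 j wrk by (simp add: segtape_nth segtape_update map_update move_def)
    from reaches_step[OF this] have "vote_begins x r n s (q = pacc A) 1 A (conf (Sim q s) lo1 cs1 h) (length cs1)"
      by (rule vote_beginsI[OF _ invm]) (use h1 in auto)
    from vote_begins_trans[OF r1 this] have "vote_begins x r n s (q = pacc A) (3 * length cs + 10) A (conf (Sim q s) lo cs h) (Suc (length cs))"
      using len1 by simp
    moreover have "pstep A \<omega> (q, W, h, u) = None" for \<omega>
      using 1 by (cases "\<omega> u") (auto simp: stuck_def pstep_def)
    ultimately show ?thesis by blast
  next
    case 4
    have "mstep (mdelta A) (conf (Sim q s) lo1 cs1 h) = Some (conf (Exec q False s) lo1 cs1 h)"
      using 4 j wrk by (simp add: segtape_nth segtape_update map_update[symmetric] move_def)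
    from reaches_trans[OF r1 reaches_step[OF this]]
    have "reaches (mdelta A) (conf (Sim q s) lo cs h) (3 * length cs + 9) (conf (Exec q False s) lo1 cs1 h)"
      by (rule reaches_mono) simp
    then show ?thesis
      by (rule exec[OF _ inv1]) (use 4 in \<open>auto simp: stuck_def pstep_def split: option.splits\<close>)
  next
    case 2
    have step: "mstep (mdelta A) (conf (Sim q s) lo1 cs1 h) = Some (conf (GoLeft (Fetch q s None)) lo1 ?m h)"
      using 2 j wrk by (simp add: segtape_nth segtape_update map_update move_def)
    obtain cs2 where f: "reaches (mdelta A) (conf (GoLeft (Fetch q s None)) lo1 ?m h) (3 * length ?m + 3)
        (conf (Exec q (r ! u) s) lo1 cs2 h)"
      "represents x r (Suc u) W (\<lambda>i. False) n lo1 cs2" "length cs2 = length ?m"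
      using fetch_bit[OF invm _ _ 2(3)] h1 by fastforce
    from reaches_trans[OF r1 reaches_step_trans[OF step f(1)]]
    have "reaches (mdelta A) (conf (Sim q s) lo cs h) (3 * length cs + 9) (conf (Exec q (r ! u) s) lo1 cs2 h)"
      by (rule reaches_mono) (use len1 in simp)
    then show ?thesis
      by (rule exec[OF _ f(2)]) (use 2 f in \<open>auto simp: stuck_def ext_def pstep_def split: option.splits\<close>)
  next
    case 3
    have step: "mstep (mdelta A) (conf (Sim q s) lo1 cs1 h) = Some (conf (GoLeft (Fetch q s None)) lo1 ?m h)"
      using 3 j wrk by (simp add: segtape_nth segtape_update map_update move_def)
    have "restart_begins x r (2 * length ?m + 2) A (conf (GoLeft (Fetch q s None)) lo1 ?m h) (Suc (length ?m))"
      using invm 3 h1 by (intro fetch_fails) auto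
    from restart_begins_trans[OF reaches_trans[OF r1 reaches_step[OF step]] this]
    have "restart_begins x r (3 * length cs + 10) A (conf (Sim q s) lo cs h) (Suc (Suc (length cs)))"
      using len1 by simp
    moreover obtain b z where b: "pdelta A q (W h) b = Some z"
      using 3(1,2) by (auto simp: stuck_def)
    \<comment> \<open>Since \<open>q\<close> is not stuck, some value \<open>b\<close> of the
      missing bit permits a transition; continuing \<open>r\<close> with \<open>b\<close> makes
      \<open>A\<close> consume bit number \<open>length r + 1\<close>.\<close>
    define \<omega> where "\<omega> i = (if i < length r then r ! i else b)" for i
    have "ext r \<omega>" by (simp add: ext_def \<omega>_def)
    moreover have "\<omega> u = b" using 3 by (simp add: \<omega>_def)
    then have "\<exists>c. pstep A \<omega> (q, W, h, u) = Some c \<and> length r < bits_used c"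
      using 3 b by (cases z) (auto simp: pstep_def stuck_def bits_used_def)
    ultimately show ?thesis by blast
  qed
qed

section \<open>Rounds of the enumeration\<close>

lemma pconf_at_halted: "phalted A \<omega> (pconf_at A x \<omega> t) \<Longrightarrow> pconf_at A x \<omega> (t + n) = pconf_at A x \<omega> t"
  by (induction n) (auto simp: phalted_def)

lemma pconf_at_halted_le:
  assumes "phalted A \<omega> (pconf_at A x \<omega> t)" "t \<le> t'"
  shows "pconf_at A x \<omega> t' = pconf_at A x \<omega> t"
  using pconf_at_halted[OF assms(1), of "t' - t"] assms(2) by simp

lemma bits_used_mono: "t \<le> t' \<Longrightarrow> bits_used (pconf_at A x \<omega> t) \<le> bits_used (pconf_at A x \<omega> t')"
proof (induction rule: dec_induct)
  case (step m)
  have "bits_used c \<le> bits_used c'" if "pstep A \<omega> c = Some c'" for c c'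
    using that by (cases c) (auto simp: pstep_def bits_used_def Let_def split: if_splits option.splits)
  then have "bits_used (pconf_at A x \<omega> m) \<le> bits_used (pconf_at A x \<omega> (Suc m))"
    by (cases "pstep A \<omega> (pconf_at A x \<omega> m)") simp_all
  then show ?case using step by linarith
qed simp

definition padded :: "bool list \<Rightarrow> nat \<Rightarrow> bool" where
  "padded r i \<longleftrightarrow> i < length r \<and> r ! i"

lemma ext_padded: "ext r (padded r)"
  by (simp add: ext_def padded_def)

text \<open>A single \<open>t\<close> serves all extensions, so the outcome is a property of the
  finite string \<open>r\<close> alone.\<close>

definition settled :: "ptm \<Rightarrow> bool list \<Rightarrow> bool list \<Rightarrow> bool \<Rightarrow> bool" where
  "settled A x r w \<longleftrightarrow> (\<exists>t. \<forall>\<omega>. ext r \<omega> \<longrightarrow> phalted A \<omega> (pconf_at A x \<omega> t) \<and>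
     bits_used (pconf_at A x \<omega> t) \<le> length r \<and> (fst (pconf_at A x \<omega> t) = pacc A) = w)"

lemma settled_paccepts:
  assumes "settled A x r w"
  shows "paccepts A x (padded r) = w"
proof -
  obtain t where t: "phalted A (padded r) (pconf_at A x (padded r) t)"
    "(fst (pconf_at A x (padded r) t) = pacc A) = w"
    using assms ext_padded unfolding settled_def by blast
  have "pconf_at A x (padded r) t' = pconf_at A x (padded r) t"
    if "phalted A (padded r) (pconf_at A x (padded r) t')" for t'
    using pconf_at_halted_le[OF that] pconf_at_halted_le[OF t(1)] by (metis linear)
  then show ?thesis using t unfolding paccepts_def by metis
qed

lemma settled_bits_used:
  assumes "settled A x r w" "ext r \<omega>"
  shows "bits_used (pconf_at A x \<omega> t') \<le> length r"
proof -
  obtain t where t: "phalted A \<omega> (pconf_at A x \<omega> t)" "bits_used (pconf_at A x \<omega> t) \<le> length r"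
    using assms unfolding settled_def by blast
  show ?thesis
  proof (cases "t' \<le> t")
    case True
    then show ?thesis using bits_used_mono[OF True, of A x \<omega>] t by linarith
  next
    case False
    then show ?thesis using pconf_at_halted_le[OF t(1), of t'] t by simp
  qed
qed

text \<open>Certifies that \<open>L\<close> does not exceed the bound chosen in
  \<open>acc_prob\<close>. Together with all strings of length \<open>L\<close> being settled, it
  identifies the two.\<close>

definition needs_bits :: "ptm \<Rightarrow> bool list \<Rightarrow> nat \<Rightarrow> bool" where
  "needs_bits A x L \<longleftrightarrow> (\<exists>\<omega> t. L \<le> bits_used (pconf_at A x \<omega> t))"

text \<open>\<open>m\<close> is the remaining running time of \<open>A\<close>. A simulated step
  costs time linear in the tape and adds at most one cell if the simulation goes on, so each of at
  most \<open>m + 1\<close> steps is charged for \<open>length cs + m\<close> cells. The 2 in the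
  space bound covers a last blank cell and a new random bit.\<close>

lemma run_outcome:
  assumes "represents x r u W (\<lambda>i. False) n lo cs" "lo - 1 \<le> h" "h \<le> lo + int (length cs)"
    "\<And>\<omega>. ext r \<omega> \<Longrightarrow> pconf_at A x \<omega> t = (q, W, h, u)"
    "\<And>\<omega>. phalted A \<omega> (pconf_at A x \<omega> (t + m))"
  shows "(\<exists>w. vote_begins x r n s w (Suc m * (3 * (length cs + m) + 10)) A (conf (Sim q s) lo cs h)
        (length cs + m + 2) \<and> settled A x r w) \<or>
    (restart_begins x r (Suc m * (3 * (length cs + m) + 10)) A (conf (Sim q s) lo cs h) (length cs + m + 2) \<and>
      needs_bits A x (Suc (length r)))"
  using assms
proof (induction m arbitrary: u W lo cs h t q)
  case (Suc m)
  consider (V) "vote_begins x r n s (q = pacc A) (3 * length cs + 10) A (conf (Sim q s) lo cs h) (Suc (length cs))"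
      "\<forall>\<omega>. ext r \<omega> \<longrightarrow> pstep A \<omega> (q, W, h, u) = None"
    | (R) "restart_begins x r (3 * length cs + 10) A (conf (Sim q s) lo cs h) (Suc (Suc (length cs)))"
      "\<exists>\<omega> c. ext r \<omega> \<and> pstep A \<omega> (q, W, h, u) = Some c \<and> length r < bits_used c"
    | (S) q' W' h' u' lo' cs' where
      "reaches (mdelta A) (conf (Sim q s) lo cs h) (3 * length cs + 10) (conf (Sim q' s) lo' cs' h')"
      "\<forall>\<omega>. ext r \<omega> \<longrightarrow> pstep A \<omega> (q, W, h, u) = Some (q', W', h', u')"
      "represents x r u' W' (\<lambda>i. False) n lo' cs'" "lo' - 1 \<le> h'" "h' \<le> lo' + int (length cs')"
      "length cs' \<le> Suc (length cs)"
    using sim_step[OF Suc.prems(1-3), where s = s and A = A and q = q] by blast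
  then show ?case
  proof cases
    case V
    have "phalted A \<omega> (pconf_at A x \<omega> t) \<and> bits_used (pconf_at A x \<omega> t) \<le> length r \<and>
        (fst (pconf_at A x \<omega> t) = pacc A) = (q = pacc A)" if "ext r \<omega>" for \<omega>
      using Suc.prems(1) Suc.prems(4)[OF that] V(2) that
      by (simp add: phalted_def bits_used_def represents_def)
    then have "settled A x r (q = pacc A)" unfolding settled_def by blast
    moreover have "vote_begins x r n s (q = pacc A) (Suc (Suc m) * (3 * (length cs + Suc m) + 10)) A
        (conf (Sim q s) lo cs h) (length cs + Suc m + 2)"
      by (rule vote_begins_trans[OF reaches_refl[of _ _ 0] V(1)]) (simp_all add: algebra_simps)
    ultimately show ?thesis by blast
  next
    case R
    then obtain \<omega> c where "ext r \<omega>" "pstep A \<omega> (q, W, h, u) = Some c" "length r < bits_used c" by blast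
    then have "Suc (length r) \<le> bits_used (pconf_at A x \<omega> (Suc t))" using Suc.prems(4) by simp
    then have "needs_bits A x (Suc (length r))" unfolding needs_bits_def by blast
    moreover have "restart_begins x r (Suc (Suc m) * (3 * (length cs + Suc m) + 10)) A
        (conf (Sim q s) lo cs h) (length cs + Suc m + 2)"
      by (rule restart_begins_trans[OF reaches_refl[of _ _ 0] R(1)]) (simp_all add: algebra_simps)
    ultimately show ?thesis by blast
  next
    case S
    have at: "pconf_at A x \<omega> (Suc t) = (q', W', h', u')" if "ext r \<omega>" for \<omega>
      using Suc.prems(4)[OF that] S(2) that by simp
    have halt: "phalted A \<omega> (pconf_at A x \<omega> (Suc t + m))" for \<omega> using Suc.prems(5)[of \<omega>] by simp
    have "Suc m * (3 * (length cs' + m) + 10) \<le> Suc m * (3 * (length cs + Suc m) + 10)"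
      using S(6) by (intro mult_le_mono2) simp
    then have time: "3 * length cs + 10 + Suc m * (3 * (length cs' + m) + 10)
        \<le> Suc (Suc m) * (3 * (length cs + Suc m) + 10)" by simp
    have space: "length cs' + m + 2 \<le> length cs + Suc m + 2" using S(6) by simp
    from Suc.IH[OF S(3-5) at halt] show ?thesis
      using vote_begins_trans[OF S(1) _ time space] restart_begins_trans[OF S(1) _ time space] by blast
  qed
next
  case 0
  note step = sim_step[OF "0.prems"(1-3), where s = s and A = A and q = q]
  have none: "pstep A \<omega> (q, W, h, u) = None" if "ext r \<omega>" for \<omega>
    using "0.prems"(4)[OF that] "0.prems"(5)[of \<omega>] by (simp add: phalted_def)
  \<comment> \<open>\<open>A\<close> has halted at time \<open>t\<close>, which excludes the two
    other outcomes. The third one speaks of all extensions, and \<open>padded r\<close> shows that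
    there is one.\<close>
  have V: "vote_begins x r n s (q = pacc A) (3 * length cs + 10) A (conf (Sim q s) lo cs h) (Suc (length cs))"
    using step none ext_padded[of r] by fastforce
  have "phalted A \<omega> (pconf_at A x \<omega> t) \<and> bits_used (pconf_at A x \<omega> t) \<le> length r \<and>
      (fst (pconf_at A x \<omega> t) = pacc A) = (q = pacc A)" if "ext r \<omega>" for \<omega>
    using "0.prems"(1) "0.prems"(4)[OF that] none[OF that]
    by (simp add: phalted_def bits_used_def represents_def)
  then have "settled A x r (q = pacc A)" unfolding settled_def by blast
  moreover have "vote_begins x r n s (q = pacc A) (Suc 0 * (3 * (length cs + 0) + 10)) A
      (conf (Sim q s) lo cs h) (length cs + 0 + 2)"
    by (rule vote_begins_trans[OF reaches_refl[of _ _ 0] V]) simp_all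
  ultimately show ?case by blast
qed

text \<open>A zero vote may carry either sign, so sign and tally are not determined by the sum. In
  the last round only the sign is output; \<open>n'\<close> then is the tally that would result,
  even if its mark is not written.\<close>

lemma vote_round:
  assumes rep: "represents x r u W (\<lambda>i. i = h) n lo cs" and h: "lo \<le> h" "h < lo + int (length cs)"
    and incr: "incr True r = (c, r')"
  shows "\<exists>s' n'. (if s' then int n' else - int n') = (if s then int n else - int n) + (if w then 1 else -1) \<and>
    (if c then \<exists>e. reaches (mdelta A) (conf (GoLeft (Vote w s True False)) lo cs h) (3 * length cs + 4) e \<and>
        fst e = (if s' then Acc else Rej)
     else \<exists>lo' cs'. reaches (mdelta A) (conf (GoLeft (Vote w s True False)) lo cs h) (3 * length cs + 4)
          (conf (Sim 1 s') lo' cs' 0) \<and>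
        represents x r' 0 (init_tape x) (\<lambda>i. False) n' lo' cs' \<and> length cs' \<le> Suc (length cs))"
proof -
  obtain w1 cs1 where sweep: "sweep_list (Vote w s True False) cs = (w1, cs1)" by fastforce
  have "map fst (rbits cs) = map (\<lambda>b. b) (take u r) @ map (\<lambda>b. b) (drop u r)"
    using rep by (simp add: represents_def comp_def)
  then have "map fst (rbits cs) = r" by simp
  then have "incr True (map fst (rbits cs)) = (c, r')" using incr by simp
  note tracks = vote_tracks[OF sweep this]
  obtain d where d: "w1 = Vote w s c d"
    "s = w \<longrightarrow> d = False \<and> length (filter tally cs1) = length (filter tally cs)"
    "s \<noteq> w \<longrightarrow> length (filter tally cs1) + of_bool d = length (filter tally cs) \<and>
        (d \<or> length (filter tally cs1) = 0)"
    using tracks by auto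
  have len: "length cs1 = length cs" using length_sweep_list[of _ cs] sweep by (metis snd_conv)
  have n: "length (filter tally cs) = n" using rep by (simp add: represents_def)
  define s' where "s' = (if d then s else w)"
  define n' where "n' = (if d then length (filter tally cs1) else Suc (length (filter tally cs1)))"
  have votes: "(if s' then int n' else - int n') = (if s then int n else - int n) + (if w then 1 else -1)"
    using d(2,3) n unfolding s'_def n'_def by (cases s; cases w; cases d) auto
  have rep1: "represents x r' 0 (init_tape x) (\<lambda>i. i = 0) (length (filter tally cs1)) lo cs1"
    using rep tracks by (simp add: represents_def holds_input_def)
  have zero: "lo \<le> 0" "0 < lo + int (length cs)"
    using rep holds_input_zero by (auto simp: represents_def)
  have pass: "reaches (mdelta A) (conf (GoLeft (Vote w s True False)) lo cs h) (2 * length cs + 1)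
      (conf (Sweep (Vote w s c d)) lo cs1 (lo + int (length cs)))"
    using reaches_pass[OF sweep h] d(1) by simp
  show ?thesis
  proof (cases c)
    case True
    let ?e = "(if s' then Acc else Rej, segtape None lo (map Some cs1), lo + int (length cs))"
    have "mstep (mdelta A) (conf (Sweep (Vote w s c d)) lo cs1 (lo + int (length cs))) = Some ?e"
      using True len by (simp add: s'_def segtape_outside move_def fun_upd_idem_iff)
    from reaches_trans[OF pass reaches_step[OF this]]
    have "reaches (mdelta A) (conf (GoLeft (Vote w s True False)) lo cs h) (3 * length cs + 4) ?e"
      by (rule reaches_mono) simp
    then have "\<exists>e. reaches (mdelta A) (conf (GoLeft (Vote w s True False)) lo cs h) (3 * length cs + 4) e \<and>
        fst e = (if s' then Acc else Rej)" by (intro exI[of _ ?e]) simp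
    then show ?thesis unfolding if_P[OF True] using votes by blast
  next
    case False
    define cs2 where "cs2 = (if d then cs1 else cs1 @ [blank_cell\<lparr>tally := True\<rparr>])"
    define h2 where "h2 = lo + int (length cs2) - 1"
    have len2: "length cs2 \<le> Suc (length cs)" "length cs \<le> length cs2" using len by (simp_all add: cs2_def)
    have rep2: "represents x r' 0 (init_tape x) (\<lambda>i. i = 0) n' lo cs2"
      using rep1 unfolding cs2_def n'_def represents_def holds_input_def
      by (simp add: fresh_cell_def segtape_snoc_default rbits_append map_filter_simps)
    have step: "mstep (mdelta A) (conf (Sweep (Vote w s c d)) lo cs1 (lo + int (length cs))) = Some (conf (Back (Sim 1 s')) lo cs2 h2)"
      using False len segtape_snoc[of None lo "map Some cs1" "Some (blank_cell\<lparr>tally := True\<rparr>)"]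
      by (simp add: s'_def cs2_def h2_def segtape_outside move_def fun_upd_idem_iff)
    have return: "reaches (mdelta A) (conf (Back (Sim 1 s')) lo cs2 h2) (Suc (nat (h2 - 0)))
        (conf (Sim 1 s') lo (map unmark cs2) 0)"
      using rep2 zero len2 unfolding h2_def by (intro reaches_back) (auto simp: represents_def)
    from reaches_trans[OF pass reaches_step_trans[OF step return]]
    have "reaches (mdelta A) (conf (GoLeft (Vote w s True False)) lo cs h) (3 * length cs + 4)
        (conf (Sim 1 s') lo (map unmark cs2) 0)"
      by (rule reaches_mono) (use zero len2 in \<open>simp add: h2_def\<close>)
    moreover have "length (map unmark cs2) \<le> Suc (length cs)" using len2 by simp
    ultimately have "\<exists>lo' cs'. reaches (mdelta A) (conf (GoLeft (Vote w s True False)) lo cs h) (3 * length cs + 4)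
          (conf (Sim 1 s') lo' cs' 0) \<and>
        represents x r' 0 (init_tape x) (\<lambda>i. False) n' lo' cs' \<and> length cs' \<le> Suc (length cs)"
      using represents_unmark[OF rep2] by blast
    then show ?thesis unfolding if_not_P[OF False] using votes by blast
  qed
qed

lemma restart_round:
  assumes inp: "holds_input x lo cs" and h: "lo \<le> h" "h < lo + int (length cs)"
  shows "\<exists>lo' cs'. reaches (mdelta A) (conf (GoLeft Restart) lo cs h) (3 * length cs + 4) (conf (Sim 1 True) lo' cs' 0) \<and>
    represents x (replicate (length (rbits cs)) False) 0 (init_tape x) (\<lambda>i. False) 0 lo' cs' \<and>
    length cs' = length cs"
proof -
  obtain cs1 where sweep: "sweep_list Restart cs = (Restart, cs1)"
    and tracks: "map inp cs1 = map inp cs" "map wrk cs1 = map inp cs" "map here cs1 = map home cs"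
      "map home cs1 = map home cs" "rbits cs1 = replicate (length (rbits cs)) (False, False)"
      "filter tally cs1 = []"
    using restart_tracks by metis
  have len: "length cs1 = length cs" using length_sweep_list[of _ cs] sweep by (metis snd_conv)
  have rep: "represents x (replicate (length (rbits cs)) False) 0 (init_tape x) (\<lambda>i. i = 0) 0 lo cs1"
    using inp tracks by (simp add: represents_def holds_input_def)
  have zero: "lo \<le> 0" "0 < lo + int (length cs)" using holds_input_zero[OF inp] by auto
  have step: "mstep (mdelta A) (conf (Sweep Restart) lo cs1 (lo + int (length cs))) =
      Some (conf (Back (Sim 1 True)) lo cs1 (lo + int (length cs) - 1))"
    using len by (simp add: segtape_outside move_def fun_upd_idem_iff)
  have return: "reaches (mdelta A) (conf (Back (Sim 1 True)) lo cs1 (lo + int (length cs) - 1))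
      (Suc (nat (lo + int (length cs) - 1 - 0))) (conf (Sim 1 True) lo (map unmark cs1) 0)"
    using rep zero len by (intro reaches_back) (auto simp: represents_def)
  from reaches_trans[OF reaches_pass[OF sweep h] reaches_step_trans[OF step return]]
  have "reaches (mdelta A) (conf (GoLeft Restart) lo cs h) (3 * length cs + 4) (conf (Sim 1 True) lo (map unmark cs1) 0)"
    by (rule reaches_mono) (use zero in simp)
  moreover have "length (map unmark cs1) = length cs" using len by simp
  ultimately show ?thesis using represents_unmark[OF rep] by blast
qed

section \<open>Vote over all strings of one length and the number of rounds\<close>

definition vote_sum :: "ptm \<Rightarrow> bool list \<Rightarrow> bool list set \<Rightarrow> int" where
  "vote_sum A x S = (\<Sum>r\<in>S. if paccepts A x (padded r) then 1 else -1)"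

text \<open>Both inequalities are weak because a zero sum can be stored with either sign; the error
  bounds exclude zero later.\<close>

definition verdict :: "ptm \<Rightarrow> bool list \<Rightarrow> bool \<Rightarrow> bool" where
  "verdict A x b \<longleftrightarrow> (\<exists>L. needs_bits A x L \<and> (\<forall>r. length r = L \<longrightarrow> (\<exists>w. settled A x r w)) \<and>
     (if b then 0 \<le> vote_sum A x {r. length r = L} else vote_sum A x {r. length r = L} \<le> 0))"

definition below :: "bool list \<Rightarrow> bool list set" where
  "below r = {r'. length r' = length r \<and> bits_val r' < bits_val r}"

lemma finite_bool_lists: "finite {r :: bool list. length r = L}"
  using finite_lists_length_eq[of "UNIV :: bool set" L] by simp

lemma card_bool_lists: "card {r :: bool list. length r = L} = 2 ^ L"
  using card_lists_length_eq[of "UNIV :: bool set" L] by (simp add: card_UNIV_bool)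

lemma finite_below: "finite (below r)"
  by (rule finite_subset[OF _ finite_bool_lists[of "length r"]]) (auto simp: below_def)

lemma insert_below: "insert r (below r) = {r'. length r' = length r \<and> bits_val r' < Suc (bits_val r)}"
  unfolding below_def using bits_val_inj[of _ r] by (auto simp: less_Suc_eq)

lemma vote_sum_insert_below:
  "settled A x r w \<Longrightarrow> vote_sum A x (insert r (below r)) = vote_sum A x (below r) + (if w then 1 else -1)"
  using finite_below[of r] settled_paccepts[of A x r w]
  by (simp add: vote_sum_def below_def)

text \<open>The first summand is the simulation of one run from \<open>run_outcome\<close>, the
  second the closing sweep over the at most \<open>l + T + 2\<close> cells then in use.\<close>

definition round_time :: "nat \<Rightarrow> nat \<Rightarrow> nat" where
  "round_time T l = Suc T * (3 * (l + T) + 10) + (3 * (l + T + 2) + 4)"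

lemma round_time_mono: "l \<le> l' \<Longrightarrow> round_time T l \<le> round_time T l'"
  unfolding round_time_def by (intro add_mono mult_le_mono) auto

text \<open>Induction on \<open>m\<close>, a bound for the remaining rounds. The vote covers exactly
  the strings \<open>below r\<close>, all of the current length, so a restart begins again with an
  empty sum.\<close>

lemma enumeration:
  assumes N: "\<not> needs_bits A x (Suc N)" and halt: "\<And>\<omega>. phalted A \<omega> (pconf_at A x \<omega> T)"
  shows "represents x r 0 (init_tape x) (\<lambda>i. False) n lo cs \<Longrightarrow> needs_bits A x (length r) \<Longrightarrow>
    (\<forall>r'\<in>below r. \<exists>w. settled A x r' w) \<Longrightarrow>
    (if s then int n else - int n) = vote_sum A x (below r) \<Longrightarrow>
    2 ^ Suc N \<le> 2 ^ length r + bits_val r + m \<Longrightarrow>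
    \<exists>e b. reaches (mdelta A) (conf (Sim 1 s) lo cs 0) (m * round_time T (length cs + m * (T + 3))) e \<and>
      fst e = (if b then Acc else Rej) \<and> verdict A x b"
proof (induction m arbitrary: r n s lo cs)
  case 0
  have "length r < Suc N"
  proof (rule ccontr)
    assume "\<not> length r < Suc N"
    then show False using 0(2) N unfolding needs_bits_def by (meson not_less order_trans)
  qed
  then have "(2::nat) ^ Suc (length r) \<le> 2 ^ Suc N" by (intro power_increasing) auto
  then have False using 0(5) bits_val_less[of r] unfolding power_Suc by linarith
  then show ?case ..
next
  case (Suc m)
  let ?l = "length cs"
  have zero: "lo - 1 \<le> 0" "0 \<le> lo + int ?l"
    using Suc.prems(1) holds_input_zero[of x lo cs] by (auto simp: represents_def)
  have outcome: "(\<exists>w. vote_begins x r n s w (Suc T * (3 * (?l + T) + 10)) A (conf (Sim 1 s) lo cs 0)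
        (?l + T + 2) \<and> settled A x r w) \<or>
    (restart_begins x r (Suc T * (3 * (?l + T) + 10)) A (conf (Sim 1 s) lo cs 0) (?l + T + 2) \<and>
      needs_bits A x (Suc (length r)))"
    using halt by (intro run_outcome[OF Suc.prems(1) zero, where t = 0]) auto
  \<comment> \<open>A run adds up to \<open>T + 2\<close> cells and its vote one more, hence
    \<open>T + 3\<close> per round. Every round is charged for the final tape length.\<close>
  have total: "round_time T ?l + m * round_time T (l' + m * (T + 3))
      \<le> Suc m * round_time T (?l + Suc m * (T + 3))" if "l' \<le> ?l + T + 3" for l'
  proof -
    have "m * round_time T (l' + m * (T + 3)) \<le> m * round_time T (?l + Suc m * (T + 3))"
      using that by (intro mult_le_mono2 round_time_mono) simp
    moreover have "round_time T ?l \<le> round_time T (?l + Suc m * (T + 3))" by (intro round_time_mono) simp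
    ultimately show ?thesis unfolding mult_Suc[of m] by linarith
  qed
  from outcome show ?case
  proof (elim disjE exE conjE)
    fix w assume vote: "vote_begins x r n s w (Suc T * (3 * (?l + T) + 10)) A (conf (Sim 1 s) lo cs 0) (?l + T + 2)"
      and settled: "settled A x r w"
    obtain u W lo1 cs1 h where
      r1: "reaches (mdelta A) (conf (Sim 1 s) lo cs 0) (Suc T * (3 * (?l + T) + 10))
        (conf (GoLeft (Vote w s True False)) lo1 cs1 h)"
      and rep1: "represents x r u W (\<lambda>i. i = h) n lo1 cs1" "lo1 \<le> h" "h < lo1 + int (length cs1)"
      and len1: "length cs1 \<le> ?l + T + 2"
      using vote unfolding vote_begins_def by blast
    obtain c r' where incr: "incr True r = (c, r')" by fastforce
    note val = incr_val[OF incr]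
    obtain s' n' where votes: "(if s' then int n' else - int n') = (if s then int n else - int n) + (if w then 1 else -1)"
      and next_round: "if c then \<exists>e. reaches (mdelta A) (conf (GoLeft (Vote w s True False)) lo1 cs1 h) (3 * length cs1 + 4) e \<and>
        fst e = (if s' then Acc else Rej)
     else \<exists>lo' cs'. reaches (mdelta A) (conf (GoLeft (Vote w s True False)) lo1 cs1 h) (3 * length cs1 + 4)
          (conf (Sim 1 s') lo' cs' 0) \<and>
        represents x r' 0 (init_tape x) (\<lambda>i. False) n' lo' cs' \<and> length cs' \<le> Suc (length cs1)"
      using vote_round[OF rep1 incr, where A = A and w = w and s = s] by metis
    have sum: "(if s' then int n' else - int n') = vote_sum A x (insert r (below r))"
      using votes Suc.prems(4) vote_sum_insert_below[OF settled] by simp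
    have all_settled: "\<forall>r'\<in>insert r (below r). \<exists>w. settled A x r' w" using Suc.prems(3) settled by blast
    show ?thesis
    proof (cases c)
      case True
      \<comment> \<open>The carry shows that \<open>r\<close> is the last string of its length, so
        the strings that have voted are all of them.\<close>
      have "Suc (bits_val r) = 2 ^ length r" using val bits_val_less[of r] True by simp
      then have all: "insert r (below r) = {r'. length r' = length r}"
        unfolding insert_below using bits_val_less by (metis (no_types, lifting))
      have "(if s' then 0 \<le> vote_sum A x {r'. length r' = length r} else vote_sum A x {r'. length r' = length r} \<le> 0)"
        using sum unfolding all by (cases s') simp_all
      moreover have "\<forall>r'. length r' = length r \<longrightarrow> (\<exists>w. settled A x r' w)" using all_settled unfolding all by simp
      ultimately have "verdict A x s'" unfolding verdict_def using Suc.prems(2) by blast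
      moreover obtain e where e: "reaches (mdelta A) (conf (GoLeft (Vote w s True False)) lo1 cs1 h) (3 * length cs1 + 4) e"
        "fst e = (if s' then Acc else Rej)"
        using next_round unfolding if_P[OF True] by blast
      have "reaches (mdelta A) (conf (Sim 1 s) lo cs 0) (Suc m * round_time T (?l + Suc m * (T + 3))) e"
        by (rule reaches_mono[OF reaches_trans[OF r1 e(1)]])
          (use total[of ?l] len1 in \<open>simp add: round_time_def\<close>)
      ultimately show ?thesis using e(2) by blast
    next
      case False
      have val': "bits_val r' = Suc (bits_val r)" "length r' = length r" using val False by auto
      have below': "below r' = insert r (below r)" unfolding insert_below using val' by (simp add: below_def)
      obtain lo' cs' where r2: "reaches (mdelta A) (conf (GoLeft (Vote w s True False)) lo1 cs1 h) (3 * length cs1 + 4)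
          (conf (Sim 1 s') lo' cs' 0)"
        and rep': "represents x r' 0 (init_tape x) (\<lambda>i. False) n' lo' cs'" and len': "length cs' \<le> Suc (length cs1)"
        using next_round unfolding if_not_P[OF False] by blast
      have "\<exists>e b. reaches (mdelta A) (conf (Sim 1 s') lo' cs' 0) (m * round_time T (length cs' + m * (T + 3))) e \<and>
          fst e = (if b then Acc else Rej) \<and> verdict A x b"
        using Suc.prems(2,5) val' all_settled sum by (intro Suc.IH[OF rep']) (simp_all add: below')
      then obtain e b where e: "reaches (mdelta A) (conf (Sim 1 s') lo' cs' 0) (m * round_time T (length cs' + m * (T + 3))) e"
          "fst e = (if b then Acc else Rej)" "verdict A x b" by blast
      have "reaches (mdelta A) (conf (Sim 1 s) lo cs 0) (Suc m * round_time T (?l + Suc m * (T + 3))) e"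
        by (rule reaches_mono[OF reaches_trans[OF reaches_trans[OF r1 r2] e(1)]])
          (use total[of "length cs'"] len1 len' in \<open>simp add: round_time_def\<close>)
      then show ?thesis using e by blast
    qed
  next
    assume restart: "restart_begins x r (Suc T * (3 * (?l + T) + 10)) A (conf (Sim 1 s) lo cs 0) (?l + T + 2)"
      and more: "needs_bits A x (Suc (length r))"
    obtain lo1 cs1 h where
      r1: "reaches (mdelta A) (conf (Sim 1 s) lo cs 0) (Suc T * (3 * (?l + T) + 10)) (conf (GoLeft Restart) lo1 cs1 h)"
      and inp1: "holds_input x lo1 cs1" "lo1 \<le> h" "h < lo1 + int (length cs1)"
      and bits1: "length (rbits cs1) = Suc (length r)" and len1: "length cs1 \<le> ?l + T + 2"
      using restart unfolding restart_begins_def by blast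
    define r' where "r' = replicate (Suc (length r)) False"
    obtain lo' cs' where r2: "reaches (mdelta A) (conf (GoLeft Restart) lo1 cs1 h) (3 * length cs1 + 4) (conf (Sim 1 True) lo' cs' 0)"
      and rep': "represents x r' 0 (init_tape x) (\<lambda>i. False) 0 lo' cs'" and len': "length cs' = length cs1"
      using restart_round[OF inp1, where A = A] unfolding bits1 r'_def by blast
    have "bits_val (replicate k False) = 0" for k by (induction k) auto
    then have val': "bits_val r' = 0" "length r' = Suc (length r)" by (simp_all add: r'_def del: replicate_Suc)
    then have below': "below r' = {}" by (simp add: below_def)
    \<comment> \<open>A restart also uses up a unit of \<open>m\<close>: the value of
      \<open>r\<close> is below 2^L, so 2^L + \<open>bits_val r\<close> is below 2^(L+1), the
      measure of the new zero string.\<close>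
    have "\<exists>e b. reaches (mdelta A) (conf (Sim 1 True) lo' cs' 0) (m * round_time T (length cs' + m * (T + 3))) e \<and>
        fst e = (if b then Acc else Rej) \<and> verdict A x b"
      using more val' Suc.prems(5) bits_val_less[of r] by (intro Suc.IH[OF rep']) (simp_all add: below' vote_sum_def)
    then obtain e b where e: "reaches (mdelta A) (conf (Sim 1 True) lo' cs' 0) (m * round_time T (length cs' + m * (T + 3))) e"
        "fst e = (if b then Acc else Rej)" "verdict A x b" by blast
    have "reaches (mdelta A) (conf (Sim 1 s) lo cs 0) (Suc m * round_time T (?l + Suc m * (T + 3))) e"
      by (rule reaches_mono[OF reaches_trans[OF reaches_trans[OF r1 r2] e(1)]])
        (use total[of "length cs'"] len1 len' in \<open>simp add: round_time_def\<close>)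
    then show ?thesis using e by blast
  qed
qed

lemma start_step:
  "\<exists>cs. mstep (mdelta A) (Start, raw_cell \<circ> init_tape x, 0) = Some (conf (Sim 1 True) 0 cs 0) \<and>
     represents x [] 0 (init_tape x) (\<lambda>i. False) 0 0 cs \<and> length cs \<le> Suc (length x)"
proof -
  \<comment> \<open>For empty input the start state still creates a cell at position 0, hence the
    single blank.\<close>
  define xs where "xs = (if x = [] then [1] else map sym_of x)"
  define cs where "cs = (map fresh_cell xs)[0 := (fresh_cell (xs ! 0))\<lparr>home := True\<rparr>]"
  have xs: "length xs > 0" "length xs \<le> Suc (length x)" by (simp_all add: xs_def)
  have tape: "segtape 1 0 xs = init_tape x"
    by (auto simp: fun_eq_iff segtape_def init_tape_def xs_def nth_append)
  have raw: "raw_cell (init_tape x i) = (if i < 0 \<or> int (length x) \<le> i then None else Some (fresh_cell (xs ! nat i)))" for i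
    by (auto simp: raw_cell_def init_tape_def xs_def sym_of_def nat_less_iff)
  have "(raw_cell \<circ> init_tape x)(0 := Some ((fresh_cell (xs ! 0))\<lparr>home := True\<rparr>)) = segtape None 0 (map Some cs)"
  proof
    fix i
    show "((raw_cell \<circ> init_tape x)(0 := Some ((fresh_cell (xs ! 0))\<lparr>home := True\<rparr>))) i = segtape None 0 (map Some cs) i"
      using xs raw[of i] by (cases "x = []") (auto simp: segtape_def cs_def xs_def nth_list_update)
  qed
  moreover have "mdelta A Start ((raw_cell \<circ> init_tape x) 0) = Some (Sim 1 True, Some ((fresh_cell (xs ! 0))\<lparr>home := True\<rparr>), St)"
    using raw[of 0] by (cases x) (simp_all add: xs_def)
  ultimately have "mstep (mdelta A) (Start, raw_cell \<circ> init_tape x, 0) = Some (conf (Sim 1 True) 0 cs 0)"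
    by (simp add: move_def)
  moreover have "represents x [] 0 (init_tape x) (\<lambda>i. False) 0 0 cs"
  proof -
    have fresh: "map inp (map fresh_cell xs) = xs" "map wrk (map fresh_cell xs) = xs"
      by (simp_all add: fresh_cell_def comp_def)
    have j: "0 < length (map fresh_cell xs)" using xs by simp
    have "map inp cs = xs" "map wrk cs = xs"
      unfolding cs_def by (subst map_update_same[OF j]; use xs fresh in \<open>simp add: fresh_cell_def\<close>)+
    moreover have "map here cs = map here (map fresh_cell xs)" "map rbit cs = map rbit (map fresh_cell xs)"
      "map tally cs = map tally (map fresh_cell xs)"
      unfolding cs_def by (subst map_update_same[OF j]; use xs in \<open>simp add: fresh_cell_def\<close>)+
    moreover have "rbits (map fresh_cell ys) = []" "filter tally (map fresh_cell ys) = []" for ys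
      by (induction ys) (auto simp: map_filter_simps fresh_cell_def)
    moreover have "segtape False 0 (map here (map fresh_cell xs)) = (\<lambda>i. False)"
      by (auto simp: segtape_def fresh_cell_def fun_eq_iff)
    moreover have "segtape False 0 (map home cs) = (\<lambda>i. i = 0)"
      using xs by (auto simp: segtape_def cs_def fresh_cell_def fun_eq_iff nth_list_update nat_less_iff split: if_splits)
    ultimately show ?thesis
      using tape rbits_cong[of cs "map fresh_cell xs"] count_cong[of tally cs "map fresh_cell xs"]
      unfolding represents_def holds_input_def by simp
  qed
  moreover have "length cs \<le> Suc (length x)" using xs by (simp add: cs_def)
  ultimately show ?thesis by blast
qed

lemma machine_run:
  assumes "\<not> needs_bits A x (Suc N)" "\<And>\<omega>. phalted A \<omega> (pconf_at A x \<omega> T)"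
  shows "\<exists>e b. reaches (mdelta A) (Start, raw_cell \<circ> init_tape x, 0)
      (Suc (2 ^ Suc N * round_time T (Suc (length x) + 2 ^ Suc N * (T + 3)))) e \<and>
    fst e = (if b then Acc else Rej) \<and> verdict A x b"
proof -
  obtain cs where start: "mstep (mdelta A) (Start, raw_cell \<circ> init_tape x, 0) = Some (conf (Sim 1 True) 0 cs 0)"
    and rep: "represents x [] 0 (init_tape x) (\<lambda>i. False) 0 0 cs" and len: "length cs \<le> Suc (length x)"
    using start_step by blast
  have "needs_bits A x 0" by (simp add: needs_bits_def)
  then have "\<exists>e b. reaches (mdelta A) (conf (Sim 1 True) 0 cs 0) (2 ^ Suc N * round_time T (length cs + 2 ^ Suc N * (T + 3))) e \<and>
      fst e = (if b then Acc else Rej) \<and> verdict A x b"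
    by (intro enumeration[OF assms rep]) (simp_all add: below_def vote_sum_def)
  then obtain e b where e: "reaches (mdelta A) (conf (Sim 1 True) 0 cs 0) (2 ^ Suc N * round_time T (length cs + 2 ^ Suc N * (T + 3))) e"
      "fst e = (if b then Acc else Rej)" "verdict A x b" by blast
  have "2 ^ Suc N * round_time T (length cs + 2 ^ Suc N * (T + 3)) \<le> 2 ^ Suc N * round_time T (Suc (length x) + 2 ^ Suc N * (T + 3))"
    using len by (intro mult_le_mono2 round_time_mono) simp
  from reaches_mono[OF reaches_step_trans[OF start e(1)] Suc_leI[OF le_imp_less_Suc[OF this]]] e(2,3)
  show ?thesis by blast
qed

text \<open>The length \<open>L\<close> of the verdict is the one in \<open>acc_prob\<close>, so
  with a accepting strings the vote is 2a - 2^L. The error bounds make this at least 2^L/3 on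
  members and at most -2^L/3 on the others.\<close>

lemma verdict_correct:
  assumes bpp: "bpp_accepts A S" and v: "verdict A x b"
  shows "b \<longleftrightarrow> x \<in> S"
proof -
  obtain L where needs: "needs_bits A x L" and settled: "\<And>r. length r = L \<Longrightarrow> \<exists>w. settled A x r w"
    and sum: "if b then 0 \<le> vote_sum A x {r. length r = L} else vote_sum A x {r. length r = L} \<le> 0"
    using v unfolding verdict_def by blast
  have bound: "bits_used (pconf_at A x \<omega> t) \<le> L" for \<omega> t
  proof -
    \<comment> \<open>Every coin sequence extends its own prefix of length \<open>L\<close>, which
      is settled.\<close>
    define r where "r = map \<omega> [0..<L]"
    have r: "length r = L" "ext r \<omega>" by (simp_all add: r_def ext_def)
    then show ?thesis using settled[OF r(1)] settled_bits_used[OF _ r(2)] by metis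
  qed
  have least: "(LEAST N. \<forall>\<omega> t. bits_used (pconf_at A x \<omega> t) \<le> N) = L"
  proof (rule Least_equality)
    fix N assume "\<forall>\<omega> t. bits_used (pconf_at A x \<omega> t) \<le> N"
    then show "L \<le> N" using needs unfolding needs_bits_def by (meson order_trans)
  qed (use bound in blast)
  let ?a = "card {r. length r = L \<and> paccepts A x (padded r)}"
  have "padded r = (\<lambda>i. i < L \<and> r ! i)" if "length r = L" for r
    using that by (simp add: padded_def fun_eq_iff)
  then have "{r. length r = L \<and> paccepts A x (\<lambda>i. i < L \<and> r ! i)} = {r. length r = L \<and> paccepts A x (padded r)}"
    by auto
  then have prob: "acc_prob A x = real ?a / 2 ^ L" by (simp add: acc_prob_def least Let_def)
  have "vote_sum A x {r. length r = L} =
      (\<Sum>r\<in>{r. length r = L}. 2 * of_bool (paccepts A x (padded r)) - 1)"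
    unfolding vote_sum_def by (intro sum.cong) auto
  also have "\<dots> = 2 * (\<Sum>r\<in>{r. length r = L}. of_bool (paccepts A x (padded r))) - 2 ^ L"
    by (simp add: sum_subtractf sum_distrib_left card_bool_lists)
  also have "(\<Sum>r\<in>{r. length r = L}. of_bool (paccepts A x (padded r))) = int ?a"
    using finite_bool_lists[of L] by (simp add: of_bool_def sum.If_cases Int_def)
  finally have vs: "real_of_int (vote_sum A x {r. length r = L}) = 2 * real ?a - 2 ^ L" by simp
  have pos: "(0::real) < 2 ^ L" by simp
  show ?thesis
  proof (cases "x \<in> S")
    case True
    then have "2 / 3 \<le> real ?a / 2 ^ L" using bpp unfolding bpp_accepts_def prob[symmetric] by blast
    then have "2 * 2 ^ L \<le> 3 * real ?a" using pos by (simp add: field_simps)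
    then have "0 < real_of_int (vote_sum A x {r. length r = L})" using vs pos by linarith
    then show ?thesis using sum True by (cases b) auto
  next
    case False
    then have "real ?a / 2 ^ L \<le> 1 / 3" using bpp unfolding bpp_accepts_def prob[symmetric] by blast
    then have "3 * real ?a \<le> 2 ^ L" using pos by (simp add: field_simps)
    then have "real_of_int (vote_sum A x {r. length r = L}) < 0" using vs pos by linarith
    then show ?thesis using sum False by (cases b) auto
  qed
qed

section \<open>Polynomial bounds for the running time\<close>

lemma round_time_poly:
  assumes "1 \<le> z" "m \<le> 2 * z" "T \<le> z" "l \<le> z"
  shows "Suc (m * round_time T (l + m * (T + 3))) \<le> 249 * z ^ 4"
proof -
  have sq: "z \<le> z * z" "1 \<le> z * z" using assms(1) by simp_all
  \<comment> \<open>At most 2z rounds add 4z cells each, so the tape has at most 9z^2 cells. A round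
    then takes at most 124z^3 steps and all rounds 248z^4; the start step makes it 249.\<close>
  have "m * (T + 3) \<le> 2 * z * (4 * z)" using assms by (intro mult_le_mono) linarith+
  also have "\<dots> = 8 * (z * z)" by simp
  finally have l: "l + m * (T + 3) \<le> 9 * (z * z)" using assms(4) sq by linarith
  define p y where "p = l + m * (T + 3)" and "y = z * z"
  have p: "p \<le> 9 * y" and y: "T \<le> y" "1 \<le> y"
    using l assms(3) sq unfolding p_def y_def by linarith+
  have "3 * (p + T) + 10 \<le> 40 * y" using p y by simp
  then have "Suc T * (3 * (p + T) + 10) \<le> (2 * z) * (40 * y)"
    using assms by (intro mult_le_mono) linarith+
  then have "Suc T * (3 * (p + T) + 10) \<le> 80 * (z * y)" by (simp only: mult.assoc mult.left_commute)
  moreover have "3 * (p + T + 2) + 4 \<le> 44 * y" using p y by simp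
  moreover have "y \<le> z * y" using assms(1) by simp
  ultimately have "round_time T p \<le> 80 * (z * y) + 44 * (z * y)"
    unfolding round_time_def by (intro add_mono) linarith+
  then have "round_time T (l + m * (T + 3)) \<le> 124 * (z * (z * z))" unfolding p_def y_def by simp
  then have "m * round_time T (l + m * (T + 3)) \<le> 2 * z * (124 * (z * (z * z)))"
    using assms(2) by (intro mult_le_mono)
  moreover have "1 \<le> z ^ 4" using assms(1) by (intro one_le_power)
  moreover have "2 * z * (124 * (z * (z * z))) = 248 * z ^ 4" by (simp add: power4_eq_xxxx)
  ultimately show ?thesis by linarith
qed

text \<open>For n at most 1 the power n^K does not help and the summand K must absorb C 3^D. For
  larger n, C is at most n^C and n + 2 is at most n^2, which accounts for the 2D.\<close>

lemma poly_bound: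
  fixes C D :: nat
  shows "\<exists>K. \<forall>n. C * (n + 2) ^ D \<le> n ^ K + K"
proof -
  define K where "K = C * 3 ^ D + 2 * D"
  have "C * (n + 2) ^ D \<le> n ^ K + K" for n
  proof (cases "n \<le> 1")
    case True
    then have "C * (n + 2) ^ D \<le> C * 3 ^ D" by (intro mult_le_mono2 power_mono) auto
    then show ?thesis unfolding K_def by linarith
  next
    case False
    then have n: "2 \<le> n" by simp
    have "C \<le> 2 ^ C" using less_exp[of C] by simp
    also have "\<dots> \<le> n ^ C" using n by (intro power_mono) auto
    also have "\<dots> \<le> n ^ (C * 3 ^ D)" using n by (intro power_increasing) auto
    finally have C: "C \<le> n ^ (C * 3 ^ D)" .
    have "n + 2 \<le> n * n" using n mult_le_mono1[OF n, of n] by linarith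
    then have "(n + 2) ^ D \<le> (n ^ 2) ^ D" by (intro power_mono) (simp_all add: power2_eq_square)
    then have "C * (n + 2) ^ D \<le> n ^ (C * 3 ^ D) * n ^ (2 * D)" using C by (intro mult_le_mono) (simp_all add: power_mult)
    then show ?thesis by (simp add: K_def power_add trans_le_add1)
  qed
  then show ?thesis by blast
qed

text \<open>The bit bound \<open>N\<close> depends on the input, but the exponent \<open>c\<close>
  must be the same for all inputs to give one polynomial.\<close>

lemma log_random_bits_bound:
  assumes "log_random_bits A"
  obtains c where "\<And>x. \<exists>N. \<not> needs_bits A x (Suc N) \<and> 2 ^ N \<le> (length x + 2) ^ c"
proof -
  obtain c where c: "\<And>x \<omega> t. real (bits_used (pconf_at A x \<omega> t)) \<le> c * log 2 (real (length x) + 2)"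
    using assms unfolding log_random_bits_def by blast
  \<comment> \<open>A natural number that is at least \<open>c\<close>, even when the real constant
    is negative; 2^(k log y) is then the honest power y^k.\<close>
  define k where "k = nat \<lceil>c\<rceil>"
  have "\<exists>N. \<not> needs_bits A x (Suc N) \<and> 2 ^ N \<le> (length x + 2) ^ k" for x
  proof (intro exI conjI)
    let ?y = "real (length x) + 2"
    let ?N = "nat \<lfloor>real k * log 2 ?y\<rfloor>"
    have log: "0 \<le> log 2 ?y" by simp
    have "real (bits_used (pconf_at A x \<omega> t)) \<le> real k * log 2 ?y" for \<omega> t
    proof -
      have "c \<le> real k" unfolding k_def by linarith
      then show ?thesis using c[of x \<omega> t] mult_right_mono[OF _ log, of c "real k"] by linarith
    qed
    then have "bits_used (pconf_at A x \<omega> t) \<le> ?N" for \<omega> t by (simp add: le_nat_floor)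
    then show "\<not> needs_bits A x (Suc ?N)" unfolding needs_bits_def by (meson not_less_eq_eq)
    have "real ?N \<le> real k * log 2 ?y" using log by simp
    then have "2 powr real ?N \<le> 2 powr (log 2 ?y * real k)" by (simp add: mult.commute)
    also have "\<dots> = ?y ^ k" by (simp add: powr_powr[symmetric] powr_realpow)
    finally have "2 ^ ?N \<le> ?y ^ k" by (simp only: powr_realpow zero_less_numeral)
    then have "real (2 ^ ?N) \<le> real ((length x + 2) ^ k)" by (simp add: add.commute)
    then show "2 ^ ?N \<le> (length x + 2) ^ k" by (simp only: of_nat_le_iff)
  qed
  then show ?thesis using that by blast
qed

theorem theorem1p8:
  shows "\<not> (\<exists>A. finite_ptm A \<and> poly_time_ptm A \<and> log_random_bits A \<and> bpp_accepts A Ld)"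
proof
  assume "\<exists>A. finite_ptm A \<and> poly_time_ptm A \<and> log_random_bits A \<and> bpp_accepts A Ld"
  then obtain A where fin: "finite_ptm A" and poly: "poly_time_ptm A" and bits: "log_random_bits A"
    and bpp: "bpp_accepts A Ld" by blast
  obtain k where k: "\<And>x \<omega>. phalted A \<omega> (pconf_at A x \<omega> (length x ^ k + k))"
    using poly unfolding poly_time_ptm_def by blast
  obtain c where c: "\<And>x. \<exists>N. \<not> needs_bits A x (Suc N) \<and> 2 ^ N \<le> (length x + 2) ^ c"
    using log_random_bits_bound[OF bits] by blast
  obtain K where K: "\<And>n. (249 * (k + 2) ^ 4) * (n + 2) ^ ((c + k + 1) * 4) \<le> n ^ K + K"
    using poly_bound by blast
  have run: "\<exists>e t. t \<le> length x ^ K + K \<and> runs (mdelta A) (Start, raw_cell \<circ> init_tape x, 0) t e \<and>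
      mstep (mdelta A) e = None \<and> (fst e = Acc \<longleftrightarrow> x \<in> Ld)" for x
  proof -
    obtain N where N: "\<not> needs_bits A x (Suc N)" "2 ^ N \<le> (length x + 2) ^ c" using c by blast
    let ?n = "length x" and ?T = "length x ^ k + k"
    \<comment> \<open>A common bound for the ingredients: with P the power of n + 2, the quantities
      2^N and n + 1 are at most P, and n^k + k is at most P + kP.\<close>
    define z where "z = (k + 2) * (?n + 2) ^ (c + k + 1)"
    have pow: "(?n + 2) ^ j \<le> (?n + 2) ^ (c + k + 1)" if "j \<le> c + k + 1" for j
      using that by (intro power_increasing) auto
    have z_eq: "z = k * (?n + 2) ^ (c + k + 1) + 2 * (?n + 2) ^ (c + k + 1)"
      unfolding z_def by (rule add_mult_distrib)
    have "?n ^ k \<le> (?n + 2) ^ k" by (intro power_mono) auto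
    moreover have "k * 1 \<le> k * (?n + 2) ^ (c + k + 1)" by (intro mult_le_mono2 one_le_power) simp
    ultimately have T: "?T \<le> z" using pow[of k, OF le_trans[OF le_add2 le_add1]] unfolding z_eq by linarith
    have "2 ^ N \<le> z" using N(2) pow[of c, OF trans_le_add1[OF le_add1]] unfolding z_eq by linarith
    then have m: "2 ^ Suc N \<le> 2 * z" by simp
    have l: "Suc ?n \<le> z" using pow[of 1, OF le_add2] unfolding z_eq power_one_right by linarith
    then have "1 \<le> z" by linarith
    from round_time_poly[OF this m T l]
    have "Suc (2 ^ Suc N * round_time ?T (Suc ?n + 2 ^ Suc N * (?T + 3))) \<le> 249 * z ^ 4" .
    also have "\<dots> = (249 * (k + 2) ^ 4) * (?n + 2) ^ ((c + k + 1) * 4)"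
      unfolding z_def power_mult_distrib power_mult by simp
    also have "\<dots> \<le> ?n ^ K + K" by (rule K)
    finally have time: "Suc (2 ^ Suc N * round_time ?T (Suc ?n + 2 ^ Suc N * (?T + 3))) \<le> ?n ^ K + K" .
    obtain e b where e: "reaches (mdelta A) (Start, raw_cell \<circ> init_tape x, 0)
        (Suc (2 ^ Suc N * round_time ?T (Suc ?n + 2 ^ Suc N * (?T + 3)))) e"
      "fst e = (if b then Acc else Rej)" "verdict A x b"
      using machine_run[OF N(1) k] by blast
    have "mstep (mdelta A) e = None" using e(2) by (cases e; cases b) auto
    moreover have "fst e = Acc \<longleftrightarrow> x \<in> Ld" using e(2) verdict_correct[OF bpp e(3)] by (cases b) auto
    ultimately show ?thesis using e(1) time unfolding reaches_def by (meson order_trans)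
  qed
  have "\<exists>ts. valid_tm ts \<and> distinct ts \<and>
    (\<forall>x t e. runs (mdelta A) (Start, raw_cell \<circ> init_tape x, 0) t e \<longrightarrow> mstep (mdelta A) e = None \<longrightarrow>
       dhalted ts (dconf_at ts x t) \<and> (fst (dconf_at ts x t) = tm_acc ts \<longleftrightarrow> fst e = Acc))"
  proof (rule machine_as_trans_list)
    show "finite {t. legal_state A t}" using fin by (rule finite_legal_state)
    show "finite (insert None (Some ` cell_set A))" using finite_cell_set[OF fin] by simp
    show "raw_cell ` {1, 2, 3} \<subseteq> insert None (Some ` cell_set A)"
      by (auto simp: raw_cell_def fresh_cell_def cell_set_def work_symbols_def)
    show "inj_on raw_cell {1, 2, 3}" by (auto simp: inj_on_def raw_cell_def fresh_cell_def)
    show "t' \<in> {t. legal_state A t} \<and> a' \<in> insert None (Some ` cell_set A)"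
      if "t \<in> {t. legal_state A t}" "a \<in> insert None (Some ` cell_set A)" "mdelta A t a = Some (t', a', d)"
      for t a t' a' d
      using mdelta_closed[OF _ that(2,3)] that(1) by blast
  qed simp_all
  then obtain ts where ts: "valid_tm ts" "distinct ts"
    "\<And>x t e. runs (mdelta A) (Start, raw_cell \<circ> init_tape x, 0) t e \<Longrightarrow> mstep (mdelta A) e = None \<Longrightarrow>
       dhalted ts (dconf_at ts x t) \<and> (fst (dconf_at ts x t) = tm_acc ts \<longleftrightarrow> fst e = Acc)"
    by blast
  have "time_ok ts K"
    unfolding time_ok_def
  proof
    fix x
    obtain e t where e: "t \<le> length x ^ K + K" "runs (mdelta A) (Start, raw_cell \<circ> init_tape x, 0) t e"
      "mstep (mdelta A) e = None" using run by blast
    then show "dhalted ts (dconf_at ts x (length x ^ K + K))"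
      using ts(3)[OF e(2,3)] dconf_at_halted_le[OF _ e(1), of ts x] by simp
  qed
  moreover have "\<exists>t. dhalted ts (dconf_at ts x t) \<and> (fst (dconf_at ts x t) = tm_acc ts \<longleftrightarrow> x \<in> Ld)" for x
    using run[of x] ts(3) by blast
  ultimately show False using Ld_not_decided_in_poly_time[OF ts(1,2)] by blast
qed

end
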